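(* Let $S_1$ and $S_2$ be numerical semigroups minimally generated by $m_1<\cdots<m_d$ and $n_1<\cdots<n_k$ respectively, and let $S=\langle qm_1,\ldots,qm_d,pn_1,\ldots,pn_k\rangle$ be a specific gluing of $S_1$ and $S_2$. Then $G(S)$ is Cohen-Macaulay if and only if $G(S_1)$ is Cohen-Macaulay.
   Context: A numerical semigroup $T$ is a submonoid of $(\mathbb{Z}_{\ge 0},+)$ with finite complement; $\langle\cdots\rangle$ denotes the semigroup (with $0$) generated by the listed integers. Let $M=T\setminus\{0\}$, $nM=M+\cdots+M$ ($n$ summands), $0M=T$. For $s\in T$, $\mathrm{ord}_T(s)$ is the maximum $n\ge 0$ with $s\in nM$. Fix a field $K$; $R=K[[T]]=K[[t^s : s\in T]]$ is the numerical semigroup ring, with maximal ideal $\mathfrak m=(t^s: s\in M)$, and $G(T)=\bigoplus_{n\ge 0}\mathfrak m^n/\mathfrak m^{n+1}$ is its tangent cone. Let $e=\min M$ be the multiplicity of $T$ and let $r=\min\{r\ge 0 : (r+1)M=e+rM\}$ be the reduction number of $T$. For $x\in T$ put $l_x(T)=\max\{\mathrm{ord}_T(s+x)-\mathrm{ord}_T(x)-\mathrm{ord}_T(s) : s\in T,\ \mathrm{ord}_T(s)\le r\}$. Gluing: given positive integers $p\in S_1\setminus\{m_1,\ldots,m_d\}$ and $q\in S_2\setminus\{n_1,\ldots,n_k\}$ with $\gcd(p,q)=1$, the numerical semigroup $S=\langle qm_1,\ldots,qm_d,pn_1,\ldots,pn_k\rangle$ is called a gluing of $S_1$ and $S_2$.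 It is a specific gluing of $S_1$ and $S_2$ if $\mathrm{ord}_{S_2}(q)+l_q(S_2)\le \mathrm{ord}_{S_1}(p)$. *)

theory Defs
  imports
    "HOL-Computational_Algebra.Formal_Power_Series"
    "HOL-Library.Extended_Nat"
    "HOL-Algebra.Algebra"
begin

section \<open>Cohen-Macaulay rings\<close>

definition height :: "('a, 'b) ring_scheme \<Rightarrow> 'a set \<Rightarrow> enat" where
  "height R P = Sup {enat n | n. \<exists>C :: nat \<Rightarrow> 'a set.
     (\<forall>i\<le>n. primeideal (C i) R) \<and> (\<forall>i<n. C i \<subset> C (Suc i)) \<and> C n = P}"

text \<open>The first condition says that \<open>xs ! i\<close> is a nonzerodivisor on \<open>R\<close> modulo the ideal
  generated by the earlier entries.\<close>

definition regular_sequence :: "('a, 'b) ring_scheme \<Rightarrow> 'a list \<Rightarrow> bool" where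
  "regular_sequence R xs \<longleftrightarrow> set xs \<subseteq> carrier R \<and>
     (\<forall>i<length xs. \<forall>y\<in>carrier R.
        xs ! i \<otimes>\<^bsub>R\<^esub> y \<in> Idl\<^bsub>R\<^esub> (set (take i xs)) \<longrightarrow> y \<in> Idl\<^bsub>R\<^esub> (set (take i xs))) \<and>
     Idl\<^bsub>R\<^esub> (set xs) \<noteq> carrier R"

definition depth :: "('a, 'b) ring_scheme \<Rightarrow> 'a set \<Rightarrow> enat" where
  "depth R I = Sup {enat (length xs) | xs. regular_sequence R xs \<and> set xs \<subseteq> I}"

text \<open>The definition of Eisenbud (Commutative Algebra with a View Toward Algebraic Geometry,
  Section 18.2): a Noetherian ring is Cohen-Macaulay if the depth of every maximal ideal equals
  its codimension, that is, its height.\<close>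

definition cohen_macaulay :: "('a, 'b) ring_scheme \<Rightarrow> bool" where
  "cohen_macaulay R \<longleftrightarrow> cring R \<and> noetherian_ring R \<and>
     (\<forall>P. maximalideal P R \<longrightarrow> depth R P = height R P)"

section \<open>Associated graded rings\<close>

abbreviation ideal_power :: "('a, 'b) ring_scheme \<Rightarrow> 'a set \<Rightarrow> nat \<Rightarrow> 'a set" where
  "ideal_power R I n \<equiv> I [^]\<^bsub>ideals_set R\<^esub> n"

text \<open>An element of the direct sum of the \<open>I^n / I^(n+1)\<close> is a function whose value at \<open>n\<close> is a coset
  of \<open>I^(n+1)\<close> in \<open>I^n\<close>, almost all values being the zero coset. For \<open>i \<le> n\<close>, the product of
  \<open>x + I^(i+1)\<close> and \<open>y + I^(n-i+1)\<close> is \<open>x y + I^(n+1)\<close>; this is what \<^const>\<open>rcoset_mult\<close> modulo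
  \<open>I^(n+1)\<close> computes, also when its arguments are cosets of different ideals. These products are added
  up in \<open>R / I^(n+1)\<close>.\<close>

definition associated_graded :: "('a, 'b) ring_scheme \<Rightarrow> 'a set \<Rightarrow> (nat \<Rightarrow> 'a set) ring" where
  "associated_graded R I =
     \<lparr>carrier = {g. (\<forall>n. \<exists>x\<in>ideal_power R I n. g n = ideal_power R I (Suc n) +>\<^bsub>R\<^esub> x) \<and>
                    finite {n. g n \<noteq> ideal_power R I (Suc n)}},
      monoid.mult = (\<lambda>g h n. finsum (R Quot ideal_power R I (Suc n))
                (\<lambda>i. rcoset_mult R (ideal_power R I (Suc n)) (g i) (h (n - i))) {..n}),
      monoid.one = (\<lambda>n. if n = 0 then ideal_power R I (Suc 0) +>\<^bsub>R\<^esub> \<one>\<^bsub>R\<^esub> else ideal_power R I (Suc n)),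
      ring.zero = (\<lambda>n. ideal_power R I (Suc n)),
      ring.add = (\<lambda>g h n. g n <+>\<^bsub>R\<^esub> h n)\<rparr>"

section \<open>Numerical semigroups\<close>

definition numerical_semigroup :: "nat set \<Rightarrow> bool" where
  "numerical_semigroup T \<longleftrightarrow> 0 \<in> T \<and> (\<forall>a\<in>T. \<forall>b\<in>T. a + b \<in> T) \<and> finite (- T)"

inductive_set semigroup_gen :: "nat set \<Rightarrow> nat set" for A where
  zero: "0 \<in> semigroup_gen A"
| gen: "a \<in> A \<Longrightarrow> a \<in> semigroup_gen A"
| add: "a \<in> semigroup_gen A \<Longrightarrow> b \<in> semigroup_gen A \<Longrightarrow> a + b \<in> semigroup_gen A"

definition minimally_generated :: "nat set \<Rightarrow> nat list \<Rightarrow> bool" where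
  "minimally_generated T ms \<longleftrightarrow> sorted_wrt (<) ms \<and> semigroup_gen (set ms) = T \<and>
     (\<forall>B. B \<subset> set ms \<longrightarrow> semigroup_gen B \<noteq> T)"

abbreviation max_part :: "nat set \<Rightarrow> nat set" where
  "max_part T \<equiv> T - {0}"

text \<open>\<open>nM\<close>, with the convention \<open>0M = T\<close>; then \<open>1M = M + T = M\<close>.\<close>

fun multiple :: "nat set \<Rightarrow> nat \<Rightarrow> nat set" where
  "multiple T 0 = T"
| "multiple T (Suc n) = {a + b | a b. a \<in> max_part T \<and> b \<in> multiple T n}"

definition ord_sg :: "nat set \<Rightarrow> nat \<Rightarrow> nat" where
  "ord_sg T s = Max {n. s \<in> multiple T n}"

definition multiplicity_sg :: "nat set \<Rightarrow> nat" where
  "multiplicity_sg T = (LEAST s. s \<in> max_part T)"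

definition reduction_number :: "nat set \<Rightarrow> nat" where
  "reduction_number T =
     (LEAST r. multiple T (r + 1) = (\<lambda>x. multiplicity_sg T + x) ` multiple T r)"

definition l_sg :: "nat set \<Rightarrow> nat \<Rightarrow> int" where
  "l_sg T x = Max {int (ord_sg T (s + x)) - int (ord_sg T x) - int (ord_sg T s) | s.
     s \<in> T \<and> ord_sg T s \<le> reduction_number T}"

section \<open>Gluings\<close>

definition gluing :: "nat list \<Rightarrow> nat list \<Rightarrow> nat \<Rightarrow> nat \<Rightarrow> nat set \<Rightarrow> bool" where
  "gluing ms ns p q S \<longleftrightarrow> p > 0 \<and> q > 0 \<and>
     p \<in> semigroup_gen (set ms) - set ms \<and> q \<in> semigroup_gen (set ns) - set ns \<and>
     gcd p q = 1 \<and> S = semigroup_gen ((\<lambda>m. q * m) ` set ms \<union> (\<lambda>n. p * n) ` set ns)"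

definition specific_gluing :: "nat list \<Rightarrow> nat list \<Rightarrow> nat \<Rightarrow> nat \<Rightarrow> nat set \<Rightarrow> bool" where
  "specific_gluing ms ns p q S \<longleftrightarrow> gluing ms ns p q S \<and>
     int (ord_sg (semigroup_gen (set ns)) q) + l_sg (semigroup_gen (set ns)) q
       \<le> int (ord_sg (semigroup_gen (set ms)) p)"

section \<open>Numerical semigroup rings and tangent cones\<close>

text \<open>The ring \<open>K[[T]]\<close>: power series with exponents in \<open>T\<close>.\<close>

definition semigroup_ring :: "nat set \<Rightarrow> 'k::field fps ring" where
  "semigroup_ring T = \<lparr>carrier = {f. \<forall>n. fps_nth f n \<noteq> 0 \<longrightarrow> n \<in> T},
     monoid.mult = (*), monoid.one = 1, ring.zero = 0, ring.add = (+)\<rparr>"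

definition semigroup_max_ideal :: "nat set \<Rightarrow> 'k::field fps set" where
  "semigroup_max_ideal T = Idl\<^bsub>semigroup_ring T\<^esub> {fps_X ^ s | s. s \<in> max_part T}"

definition tangent_cone :: "nat set \<Rightarrow> (nat \<Rightarrow> 'k::field fps set) ring" where
  "tangent_cone T = associated_graded (semigroup_ring T) (semigroup_max_ideal T)"

end

theory Submission
  imports Defs "HOL-Computational_Algebra.Polynomial"
begin

text \<open>
  Let \<open>T\<close> be a numerical semigroup of multiplicity \<open>e\<close>. The tangent cone of \<open>K[[T]]\<close> has a \<open>K\<close>-basis
  of monomials indexed by \<open>T\<close>: the product of the monomials of \<open>a\<close> and \<open>b\<close> is the monomial of
  \<open>a + b\<close> if \<open>ord (a + b) = ord a + ord b\<close>, and zero otherwise. Let \<open>x\<close> be the monomial of \<open>e\<close>. Its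
  powers are the monomials of the multiples of \<open>e\<close>, so they span a copy of \<open>K[x]\<close>. The monomial of an
  element \<open>s\<close> that is not a multiple of \<open>e\<close> is nilpotent: \<open>e * s\<close> is also \<open>s\<close> times \<open>e\<close> and so has
  order \<open>s\<close>, which exceeds \<open>e * ord s\<close>. Thus the tangent cone is \<open>K[x]\<close> plus a nilpotent ideal, and it
  is a finitely generated \<open>K[x]\<close>-module because \<open>ord (s + e) = ord s + 1\<close> once \<open>ord s\<close> is at least
  the reduction number.

  For every such ring (\<open>nilpotent_extension\<close>) the prime ideals are those of \<open>K[x]\<close>. It is Noetherian,
  all its maximal ideals have height one, and no regular sequence in one of them has two elements, so
  it is Cohen-Macaulay exactly when every maximal ideal contains a nonzerodivisor. For the tangent cone
  this is Garcia's criterion \<open>cohen_macaulay_tangent_cone_iff\<close>: \<open>ord (s + e) = ord s + 1\<close> for all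
  \<open>s\<close> in \<open>T\<close>. If this holds, all nonzero polynomials in \<open>x\<close> are nonzerodivisors. If it fails, the
  monomial of the largest \<open>s\<close> at which it fails is annihilated by the whole homogeneous maximal ideal.

  It remains to compare orders in a gluing \<open>S\<close> with orders in \<open>S1\<close>. Each element of \<open>S\<close> is
  \<open>q * a + p * b\<close> for one pair with \<open>b - q\<close> outside \<open>S2\<close>, and all other representations arise by
  trading copies of \<open>p\<close> inside \<open>a\<close> for copies of \<open>q\<close> inside \<open>b\<close>. The inequality in the definition of
  a specific gluing says that each trade gains at most \<open>ord p\<close> in \<open>S2\<close>, and it loses at least that
  much in \<open>S1\<close>. Hence \<open>ord (q * a + p * b) = ord a + ord b\<close> for the distinguished pair
  (\<open>ord_S_apery\<close>). By the same inequality the multiplicity of \<open>S\<close> is \<open>q\<close> times that of \<open>S1\<close>, so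
  adding it changes \<open>a\<close> only, and Garcia's criterion for \<open>S\<close> becomes the criterion for \<open>S1\<close>.
\<close>

section \<open>Orders in a numerical semigroup\<close>

locale num_semigroup =
  fixes T :: "nat set"
  assumes numerical: "numerical_semigroup T"
begin

abbreviation M where "M \<equiv> max_part T"
abbreviation ord where "ord \<equiv> ord_sg T"
abbreviation e where "e \<equiv> multiplicity_sg T"

lemma zero_mem: "0 \<in> T"
  and add_mem: "a \<in> T \<Longrightarrow> b \<in> T \<Longrightarrow> a + b \<in> T"
  and cofinite: "finite (- T)"
  using numerical by (auto simp: numerical_semigroup_def)

lemma mult_mem: "a \<in> T \<Longrightarrow> k * a \<in> T"
  by (induction k) (auto simp: zero_mem add_mem)

lemma multiple_SucI: "a \<in> T \<Longrightarrow> a \<noteq> 0 \<Longrightarrow> b \<in> multiple T n \<Longrightarrow> a + b \<in> multiple T (Suc n)"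
  by auto

lemma multiple_SucE:
  assumes "s \<in> multiple T (Suc n)"
  obtains a b where "s = a + b" "a \<in> T" "a \<noteq> 0" "b \<in> multiple T n"
  using assms by auto

declare multiple.simps(2) [simp del]

lemma multiple_subset: "multiple T n \<subseteq> T"
  by (induction n) (auto intro: add_mem elim!: multiple_SucE)

lemma multiple_closed: "s \<in> multiple T n \<Longrightarrow> t \<in> T \<Longrightarrow> s + t \<in> multiple T n"
proof (induction n arbitrary: s)
  case 0 then show ?case by (simp add: add_mem)
next
  case (Suc n)
  then obtain a b where ab: "s = a + b" "a \<in> T" "a \<noteq> 0" "b \<in> multiple T n" by (elim multiple_SucE)
  then show ?case using multiple_SucI[of a "b + t" n] Suc by (simp add: add.assoc)
qed

lemma multiple_Suc_subset: "multiple T (Suc n) \<subseteq> multiple T n"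
proof
  fix s assume "s \<in> multiple T (Suc n)"
  then obtain a b where "s = a + b" "a \<in> T" "b \<in> multiple T n" by (elim multiple_SucE)
  then show "s \<in> multiple T n" using multiple_closed[of b n a] by (simp add: add.commute)
qed

lemma multiple_antimono: "m \<le> n \<Longrightarrow> multiple T n \<subseteq> multiple T m"
  using multiple_Suc_subset by (rule lift_Suc_antimono_le)

lemma multiple_ge: "s \<in> multiple T n \<Longrightarrow> n \<le> s"
  by (induction n arbitrary: s) (force elim!: multiple_SucE)+

lemma multiple_add: "s \<in> multiple T m \<Longrightarrow> t \<in> multiple T n \<Longrightarrow> s + t \<in> multiple T (m + n)"
proof (induction m arbitrary: s)
  case 0 then show ?case using multiple_closed[of t n s] by (simp add: add.commute)
next
  case (Suc m)
  then obtain a b where ab: "s = a + b" "a \<in> T" "a \<noteq> 0" "b \<in> multiple T m" by (elim multiple_SucE)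
  then show ?case using multiple_SucI[of a "b + t" "m + n"] Suc by (simp add: add.assoc)
qed

lemma multiple_iff_ord: assumes "s \<in> T" shows "s \<in> multiple T n \<longleftrightarrow> n \<le> ord s"
proof -
  have fin: "finite {n. s \<in> multiple T n}"
    by (rule finite_subset[of _ "{..s}"]) (auto dest: multiple_ge)
  have "0 \<in> {n. s \<in> multiple T n}" using assms by simp
  then have "ord s \<in> {n. s \<in> multiple T n}" unfolding ord_sg_def using fin by (metis Max_in empty_iff)
  then show ?thesis using multiple_antimono[of n "ord s"] Max_ge[OF fin, of n]
    unfolding ord_sg_def by auto
qed

lemma ord_superadd: "s \<in> T \<Longrightarrow> t \<in> T \<Longrightarrow> ord s + ord t \<le> ord (s + t)"
  using multiple_add multiple_iff_ord add_mem by blast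

lemma ord_mult_superadd: "t \<in> T \<Longrightarrow> s \<in> T \<Longrightarrow> ord s + j * ord t \<le> ord (s + j * t)"
proof (induction j)
  case (Suc j)
  then show ?case using ord_superadd[of t "s + j * t"] mult_mem[of t j] add_mem[of s "j * t"]
    by (simp add: algebra_simps)
qed simp

lemma ord_le: "s \<in> T \<Longrightarrow> ord s \<le> s"
  using multiple_iff_ord multiple_ge by blast

lemma ord_0 [simp]: "ord 0 = 0"
  using ord_le[OF zero_mem] by simp

lemma ord_pos: "s \<in> M \<Longrightarrow> 1 \<le> ord s"
  using multiple_iff_ord[of s 1] multiple_SucI[of s 0 0] zero_mem by simp

lemma exists_pos: "\<exists>s. s \<in> M"
proof (rule ccontr)
  assume "\<not> ?thesis"
  then have "- T = - {0}" using zero_mem by auto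
  then show False using cofinite by (metis finite.emptyI finite_insert finite_compl infinite_UNIV_nat)
qed

lemma e_mem: "e \<in> M"
  unfolding multiplicity_sg_def using exists_pos by (rule LeastI_ex)

lemma e_le: "s \<in> M \<Longrightarrow> e \<le> s"
  unfolding multiplicity_sg_def by (rule Least_le)

lemma e_in: "e \<in> T" and e_pos: "0 < e"
  using e_mem by auto

lemma multiple_ge_e: "s \<in> multiple T n \<Longrightarrow> n * e \<le> s"
proof (induction n arbitrary: s)
  case (Suc n)
  then obtain a b where ab: "s = a + b" "a \<in> T" "a \<noteq> 0" "b \<in> multiple T n" by (elim multiple_SucE)
  then show ?case using Suc.IH[OF ab(4)] e_le[of a] by simp
qed simp

lemma ord_e_le: "s \<in> T \<Longrightarrow> ord s * e \<le> s"
  using multiple_iff_ord multiple_ge_e by blast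

lemma ord_multiple_e: "ord (k * e) = k"
proof (rule antisym)
  have "ord (k * e) * e \<le> k * e" using ord_e_le[OF mult_mem[OF e_in]] .
  then show "ord (k * e) \<le> k" using e_pos by simp
  have "1 \<le> ord e" using ord_pos[OF e_mem] .
  then have "k \<le> k * ord e" by simp
  also have "\<dots> \<le> ord (k * e)" using ord_mult_superadd[OF e_in zero_mem, of k] by simp
  finally show "k \<le> ord (k * e)" .
qed

lemma shift_multiple: "(\<lambda>x. e + x) ` multiple T n \<subseteq> multiple T (Suc n)"
  using e_mem multiple_SucI by auto

text \<open>The complement is used to count: the number of gaps of \<open>e + A\<close> is \<open>e\<close> plus the number of gaps
  of \<open>A\<close>.\<close>

lemma compl_shift:
  fixes A :: "nat set"
  shows "- ((\<lambda>x. e + x) ` A) = {..<e} \<union> (\<lambda>x. e + x) ` (- A)"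
proof (rule Set.set_eqI)
  fix x :: nat
  show "x \<in> - ((+) e ` A) \<longleftrightarrow> x \<in> {..<e} \<union> (+) e ` (- A)"
    by (cases "x < e") (use le_iff_add[of e x] in auto)
qed

lemma card_compl_shift:
  assumes "finite (- A)"
  shows "card (- ((\<lambda>x. e + x) ` A)) = e + card (- A)"
proof -
  have "card (- ((\<lambda>x. e + x) ` A)) = card {..<e} + card ((\<lambda>x. e + x) ` (- A))"
    unfolding compl_shift using assms by (intro card_Un_disjoint) auto
  then show ?thesis by (simp add: card_image)
qed

lemma cofinite_multiple: "finite (- multiple T n)"
proof (induction n)
  case (Suc n)
  have "- multiple T (Suc n) \<subseteq> - ((\<lambda>x. e + x) ` multiple T n)" using shift_multiple by blast
  moreover have "finite (- ((\<lambda>x. e + x) ` multiple T n))" unfolding compl_shift using Suc by simp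
  ultimately show ?case by (rule finite_subset)
qed (simp add: cofinite)

lemma finite_ord_le: "finite {s \<in> T. ord s \<le> n}"
  by (rule finite_subset[OF _ cofinite_multiple[of "Suc n"]])
    (auto simp del: multiple.simps simp: multiple_iff_ord)

text \<open>Otherwise \<open>e + nM\<close> would be a proper subset of \<open>(n+1)M\<close> for every \<open>n\<close>, so that the number of gaps of
  \<open>nM\<close> would grow by less than \<open>e\<close> in each step. But it is at least \<open>n * e\<close>, as every element of
  \<open>nM\<close> is that large.\<close>

lemma reduction_exists: "\<exists>r. multiple T (r + 1) = (\<lambda>x. e + x) ` multiple T r"
proof (rule ccontr)
  assume no: "\<not> ?thesis"
  define c where "c n = card (- multiple T n)" for n
  have step: "c (Suc n) < e + c n" for n
  proof -
    have "multiple T (Suc n) \<noteq> (\<lambda>x. e + x) ` multiple T n" using no by simp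
    then have "- multiple T (Suc n) \<subset> - ((\<lambda>x. e + x) ` multiple T n)"
      using shift_multiple[of n] by blast
    then have "c (Suc n) < card (- ((\<lambda>x. e + x) ` multiple T n))"
      unfolding c_def by (rule psubset_card_mono[rotated]) (simp add: compl_shift cofinite_multiple)
    then show ?thesis by (simp add: card_compl_shift cofinite_multiple c_def)
  qed
  have up: "c n + n \<le> n * e + c 0" for n
  proof (induction n)
    case (Suc n)
    then show ?case using step[of n] by simp
  qed simp
  have low: "n * e \<le> c n" for n
  proof -
    have "{..<n * e} \<subseteq> - multiple T n" using multiple_ge_e by force
    from card_mono[OF cofinite_multiple this] show ?thesis by (simp add: c_def)
  qed
  from up[of "Suc (c 0)"] low[of "Suc (c 0)"] show False by linarith
qed

abbreviation r where "r \<equiv> reduction_number T"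

lemma reduction: "multiple T (Suc r) = (\<lambda>x. e + x) ` multiple T r"
  using LeastI_ex[OF reduction_exists] by (simp add: reduction_number_def)

lemma reduction_ge: "r \<le> n \<Longrightarrow> multiple T (Suc n) = (\<lambda>x. e + x) ` multiple T n"
proof (induction n rule: dec_induct)
  case base show ?case by (rule reduction)
next
  case (step n)
  show ?case
  proof (intro equalityI subsetI)
    fix s assume "s \<in> multiple T (Suc (Suc n))"
    then obtain a b where ab: "s = a + b" "a \<in> T" "a \<noteq> 0" "b \<in> multiple T (Suc n)"
      by (rule multiple_SucE)
    then obtain b' where b': "b = e + b'" "b' \<in> multiple T n" using step.IH by blast
    have "s = e + (a + b')" "a + b' \<in> multiple T (Suc n)" using ab b' multiple_SucI by auto
    then show "s \<in> (\<lambda>x. e + x) ` multiple T (Suc n)" by blast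
  qed (use shift_multiple in blast)
qed

text \<open>From the reduction number on, adding \<open>e\<close> is a bijection from \<open>nM\<close> onto \<open>(n+1)M\<close>, so it raises the
  order by exactly one.\<close>

lemma ord_add_e: assumes "s \<in> T" "r \<le> ord s" shows "ord (s + e) = Suc (ord s)"
proof (rule antisym)
  show "Suc (ord s) \<le> ord (s + e)"
    using ord_superadd[OF assms(1) e_in] ord_pos[OF e_mem] by linarith
  show "ord (s + e) \<le> Suc (ord s)"
  proof (rule ccontr)
    assume "\<not> ?thesis"
    then have "s + e \<in> multiple T (Suc (Suc (ord s)))"
      using multiple_iff_ord[OF add_mem[OF assms(1) e_in]] by simp
    then have "s \<in> multiple T (Suc (ord s))"
      using reduction_ge[of "Suc (ord s)"] assms(2) by (auto simp: add.commute)
    then show False using multiple_iff_ord[OF assms(1)] by simp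
  qed
qed

lemma ord_gt_reduction: 
  assumes "s \<in> T" "r < ord s"
  obtains s' where "s' \<in> T" "r \<le> ord s'" "s = s' + e" "ord s = Suc (ord s')"
proof -
  have "s \<in> multiple T (Suc r)" using assms multiple_iff_ord[of s "Suc r"] by simp
  then obtain s' where s': "s = e + s'" "s' \<in> multiple T r" using reduction by auto
  then have "s' \<in> T" "r \<le> ord s'" using multiple_subset multiple_iff_ord by blast+
  then show thesis using that[of s'] ord_add_e[of s'] s' by (simp add: add.commute)
qed

text \<open>The number \<open>l_sg T x\<close> is a maximum over the elements of order at most \<open>r\<close> only. It bounds the
  gain of order for all elements, because from order \<open>r\<close> on subtracting \<open>e\<close> from \<open>s\<close> lowers the
  orders of \<open>s\<close> and of \<open>s + x\<close> by one each.\<close>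

lemma ord_add_le_l:
  assumes "s \<in> T" "x \<in> T"
  shows "int (ord (s + x)) \<le> int (ord s) + (int (ord x) + l_sg T x)"
  using assms(1)
proof (induction s rule: less_induct)
  case (less s)
  show ?case
  proof (cases "ord s \<le> r")
    case True
    have "finite {int (ord (s + x)) - int (ord x) - int (ord s) | s. s \<in> T \<and> ord s \<le> r}"
      using finite_imageI[OF finite_ord_le[of r], of "\<lambda>s. int (ord (s + x)) - int (ord x) - int (ord s)"]
      by (rule back_subst[of finite]) auto
    then have "int (ord (s + x)) - int (ord x) - int (ord s) \<le> l_sg T x"
      unfolding l_sg_def by (rule Max_ge) (use less True in blast)
    then show ?thesis by linarith
  next
    case False
    then obtain s' where s': "s' \<in> T" "r \<le> ord s'" "s = s' + e" "ord s = Suc (ord s')"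
      using ord_gt_reduction[OF less.prems] by (metis not_le)
    have "r \<le> ord (s' + x)" using ord_superadd[OF s'(1) assms(2)] s'(2) by linarith
    then have "ord (s + x) = Suc (ord (s' + x))"
      using ord_add_e[OF add_mem[OF s'(1) assms(2)]] s'(3) by (simp add: ac_simps)
    then show ?thesis using less.IH[of s'] s' e_pos by simp
  qed
qed

lemma ord_add_mult_le_l:
  assumes "s \<in> T" "x \<in> T"
  shows "int (ord (s + j * x)) \<le> int (ord s) + int j * (int (ord x) + l_sg T x)"
proof (induction j)
  case (Suc j)
  have "int (ord (s + j * x + x)) \<le> int (ord (s + j * x)) + (int (ord x) + l_sg T x)"
    by (rule ord_add_le_l) (use assms mult_mem add_mem in auto)
  with Suc show ?case by (simp add: algebra_simps)
qed simp

text \<open>Garcia's criterion: multiplication by the initial form of \<open>t^e\<close> is injective on the tangent cone.\<close>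

definition ord_regular :: bool where
  "ord_regular \<longleftrightarrow> (\<forall>s\<in>T. ord (s + e) = Suc (ord s))"

end

section \<open>Orders in a gluing\<close>

text \<open>Choosing \<open>b\<close> in the residue class modulo \<open>q\<close> that makes \<open>n - p * b\<close> divisible by \<open>q\<close>, among
  \<open>q\<close> consecutive values starting from \<open>c\<close>, leaves enough room for \<open>a\<close>. This gives the finite
  complement of a gluing.\<close>

lemma coprime_representation:
  fixes p q c n :: nat
  assumes "coprime p q" "0 < p" "0 < q" "q * c + p * (c + q) \<le> n"
  shows "\<exists>a b. c \<le> a \<and> c \<le> b \<and> n = q * a + p * b"
proof -
  obtain b where b: "c \<le> b" "b < c + q" "(p * b) mod q = n mod q"
  proof -
    \<comment> \<open>\<open>x0 * n\<close> solves the congruence for \<open>b\<close>. Its representative in the window from \<open>c\<close> on is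
      \<open>c + (x0 * n - c) mod q\<close>, where \<open>- c\<close> is written as \<open>(q - 1) * c\<close> to stay in the naturals.\<close>
    obtain x0 y0 where bezout: "p * x0 = q * y0 + 1"
      using bezout_add_strong_nat[of p q] assms(1,2) by (metis coprime_common_divisor_nat neq0_conv)
    have "p * (x0 * n) = (q * y0 + 1) * n" unfolding bezout[symmetric] by simp
    then have x: "p * (x0 * n) = n + q * (y0 * n)" by (simp add: algebra_simps)
    define b where "b = c + (x0 * n + (q - 1) * c) mod q"
    have "b mod q = (c + (x0 * n + (q - 1) * c)) mod q" unfolding b_def by (simp add: mod_add_right_eq)
    also have "c + (x0 * n + (q - 1) * c) = x0 * n + q * c" using assms(3) by (cases q) auto
    finally have "b mod q = (x0 * n) mod q" by simp
    then have "(p * b) mod q = (p * (x0 * n)) mod q" by (metis mod_mult_right_eq)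
    also have "\<dots> = n mod q" by (simp add: x)
    finally show thesis using that[of b] assms(3) by (simp add: b_def)
  qed
  have pb: "p * b \<le> p * (c + q)" using b by simp
  then have le: "p * b + q * c \<le> n" using assms(4) by linarith
  then have "q dvd n - p * b" using b(3) by (metis add_leD1 mod_eq_dvd_iff_nat)
  then obtain a where a: "n - p * b = q * a" by (auto simp: dvd_def)
  then have "n = q * a + p * b" using le by linarith
  moreover have "q * c \<le> q * a" using a le by linarith
  then have "c \<le> a" using assms(3) by simp
  ultimately show ?thesis using b(1) by blast
qed

locale semigroup_gluing = A: num_semigroup S1 + B: num_semigroup S2 for S1 S2 +
  fixes p q :: nat
  assumes p_mem: "p \<in> S1" and q_mem: "q \<in> S2" and p_pos: "0 < p" and q_pos: "0 < q"
    and coprime: "coprime p q"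
begin

definition S :: "nat set" where "S = {q * a + p * b | a b. a \<in> S1 \<and> b \<in> S2}"

lemma S_I: "a \<in> S1 \<Longrightarrow> b \<in> S2 \<Longrightarrow> q * a + p * b \<in> S"
  unfolding S_def by blast

lemma numerical_S: "numerical_semigroup S"
  unfolding numerical_semigroup_def
proof (intro conjI ballI)
  show "0 \<in> S" using S_I[OF A.zero_mem B.zero_mem] by simp
next
  fix x y assume "x \<in> S" "y \<in> S"
  then obtain a b a' b' where "x = q * a + p * b" "y = q * a' + p * b'"
    "a \<in> S1" "b \<in> S2" "a' \<in> S1" "b' \<in> S2" unfolding S_def by blast
  then have "x + y = q * (a + a') + p * (b + b')" "a + a' \<in> S1" "b + b' \<in> S2"
    by (auto simp: algebra_simps A.add_mem B.add_mem)
  then show "x + y \<in> S" using S_I by metis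
next
  obtain c1 where c1: "\<forall>n\<in>- S1. n < c1" using finite_nat_set_iff_bounded A.cofinite by blast
  obtain c2 where c2: "\<forall>n\<in>- S2. n < c2" using finite_nat_set_iff_bounded B.cofinite by blast
  define c where "c = max c1 c2"
  have "n < q * c + p * (c + q)" if "n \<in> - S" for n
  proof (rule ccontr)
    assume "\<not> ?thesis"
    then obtain a b where "c \<le> a" "c \<le> b" "n = q * a + p * b"
      using coprime_representation[OF coprime p_pos q_pos, of c n] by auto
    moreover from this have "\<not> a < c1" "\<not> b < c2" by (auto simp: c_def)
    then have "a \<in> S1" "b \<in> S2" using c1 c2 by blast+
    ultimately show False using that S_I by blast
  qed
  then show "finite (- S)" using finite_nat_set_iff_bounded by blast
qed

sublocale C: num_semigroup S
  by unfold_locales (rule numerical_S)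

text \<open>Collect the \<open>n\<close> nonzero summands of \<open>s\<close>: each of them contributes a positive order to at least one of
  the two sides, and orders are superadditive.\<close>

lemma multiple_S_E:
  "s \<in> multiple S n \<Longrightarrow> \<exists>a\<in>S1. \<exists>b\<in>S2. s = q * a + p * b \<and> n \<le> A.ord a + B.ord b"
proof (induction n arbitrary: s)
  case 0 then show ?case by (auto simp: S_def)
next
  case (Suc n)
  then obtain u v where uv: "s = u + v" "u \<in> S" "u \<noteq> 0" "v \<in> multiple S n" by (elim C.multiple_SucE)
  obtain a b where ab: "a \<in> S1" "b \<in> S2" "u = q * a + p * b" using uv(2) by (auto simp: S_def)
  obtain a' b' where ab': "a' \<in> S1" "b' \<in> S2" "v = q * a' + p * b'" "n \<le> A.ord a' + B.ord b'"
    using Suc.IH[OF uv(4)] by blast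
  have "a \<noteq> 0 \<or> b \<noteq> 0" using ab(3) uv(3) by auto
  then have "1 \<le> A.ord a + B.ord b" using A.ord_pos[of a] B.ord_pos[of b] ab by force
  then have "Suc n \<le> A.ord (a + a') + B.ord (b + b')"
    using A.ord_superadd[OF ab(1) ab'(1)] B.ord_superadd[OF ab(2) ab'(2)] ab'(4) by linarith
  moreover have "s = q * (a + a') + p * (b + b')" using uv(1) ab(3) ab'(3) by (simp add: algebra_simps)
  ultimately show ?case using ab ab' A.add_mem B.add_mem by blast
qed

lemma scaled_multiple_A: "a \<in> multiple S1 n \<Longrightarrow> q * a \<in> multiple S n"
proof (induction n arbitrary: a)
  case 0 then show ?case using S_I[OF _ B.zero_mem] by simp
next
  case (Suc n)
  then obtain u v where uv: "a = u + v" "u \<in> S1" "u \<noteq> 0" "v \<in> multiple S1 n"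
    by (elim A.multiple_SucE)
  have "q * u + q * v \<in> multiple S (Suc n)"
    by (rule C.multiple_SucI) (use Suc.IH uv S_I[OF uv(2) B.zero_mem] q_pos in auto)
  then show ?case by (simp add: uv(1) algebra_simps)
qed

lemma scaled_multiple_B: "b \<in> multiple S2 n \<Longrightarrow> p * b \<in> multiple S n"
proof (induction n arbitrary: b)
  case 0 then show ?case using S_I[OF A.zero_mem] by simp
next
  case (Suc n)
  then obtain u v where uv: "b = u + v" "u \<in> S2" "u \<noteq> 0" "v \<in> multiple S2 n"
    by (elim B.multiple_SucE)
  have "p * u + p * v \<in> multiple S (Suc n)"
    by (rule C.multiple_SucI) (use Suc.IH uv S_I[OF A.zero_mem uv(2)] p_pos in auto)
  then show ?case by (simp add: uv(1) algebra_simps)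
qed

lemma ord_S_ge:
  assumes "a \<in> S1" "b \<in> S2"
  shows "A.ord a + B.ord b \<le> C.ord (q * a + p * b)"
proof -
  have "q * a + p * b \<in> multiple S (A.ord a + B.ord b)"
    using assms A.multiple_iff_ord B.multiple_iff_ord
    by (intro C.multiple_add scaled_multiple_A scaled_multiple_B) auto
  then show ?thesis using C.multiple_iff_ord S_I assms by blast
qed

text \<open>A representation with \<open>b\<close> minimal: if \<open>b - q\<close> were in \<open>S2\<close>, one copy of \<open>q\<close> could be traded for
  one copy of \<open>p\<close> on the other side.\<close>

lemma apery_representation:
  assumes "s \<in> S"
  shows "\<exists>a\<in>S1. \<exists>b\<in>S2. s = q * a + p * b \<and> (\<forall>b'\<in>S2. b \<noteq> b' + q)"
proof -
  define P where "P b \<longleftrightarrow> b \<in> S2 \<and> (\<exists>a\<in>S1. s = q * a + p * b)" for b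
  have "\<exists>b. P b" using assms unfolding S_def P_def by blast
  then have P: "P (LEAST b. P b)" by (rule LeastI_ex)
  define b where "b = (LEAST b. P b)"
  obtain a where a: "a \<in> S1" "s = q * a + p * b" "b \<in> S2" using P unfolding P_def b_def by blast
  have "b \<noteq> b' + q" if "b' \<in> S2" for b'
  proof
    assume "b = b' + q"
    then have "s = q * (a + p) + p * b'" using a by (simp add: algebra_simps)
    then have "P b'" unfolding P_def using that A.add_mem[OF a(1) p_mem] by blast
    then have "b \<le> b'" unfolding b_def by (rule Least_le)
    then show False using \<open>b = b' + q\<close> q_pos by simp
  qed
  with a show ?thesis by blast
qed

lemma representation_shift:
  assumes "q * a + p * b = q * a' + p * b'" "b \<le> b'"
  obtains j where "b' = b + j * q" "a = a' + j * p"
proof -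
  obtain d where d: "b' = b + d" using assms(2) by (auto simp: le_iff_add)
  have "q * a = q * a' + p * d" using assms(1) d by (simp add: algebra_simps)
  then have "q dvd p * d" by (metis dvd_add_right_iff dvd_triv_left)
  then have "q dvd d" using coprime by (simp add: coprime_commute coprime_dvd_mult_right_iff)
  then obtain j where j: "d = j * q" by (auto simp: dvd_def mult.commute)
  then have "q * a = q * (a' + j * p)" using \<open>q * a = q * a' + p * d\<close> by (simp add: algebra_simps)
  then have "a = a' + j * p" using q_pos by simp
  with that d j show thesis by blast
qed

end

locale specific_semigroup_gluing = semigroup_gluing +
  assumes specific: "int (B.ord q) + l_sg S2 q \<le> int (A.ord p)"
begin

text \<open>In any other representation \<open>b\<close> is replaced by \<open>b + j * q\<close> and \<open>a\<close> by \<open>a - j * p\<close>. The order of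
  the second summand then grows by at most \<open>j * (ord q + l_sg S2 q)\<close>, and that of the first drops by
  at least \<open>j * ord p\<close>, which is no less in a specific gluing. So the distinguished representation
  already attains the maximal order.\<close>

lemma ord_S_apery:
  assumes a: "a \<in> S1" and b: "b \<in> S2" and apery: "\<forall>b'\<in>S2. b \<noteq> b' + q"
  shows "C.ord (q * a + p * b) = A.ord a + B.ord b"
proof (rule antisym)
  have "q * a + p * b \<in> multiple S (C.ord (q * a + p * b))"
    using C.multiple_iff_ord S_I[OF a b] by blast
  then obtain a' b' where ab': "a' \<in> S1" "b' \<in> S2" "q * a + p * b = q * a' + p * b'"
    and le: "C.ord (q * a + p * b) \<le> A.ord a' + B.ord b'" using multiple_S_E by metis
  have "b \<le> b'"
  proof (rule ccontr)
    assume "\<not> b \<le> b'"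
    then obtain j where j: "b = b' + j * q" "a' = a + j * p"
      using representation_shift[OF ab'(3)[symmetric]] by (metis nat_le_linear)
    then obtain i where "j = Suc i" using \<open>\<not> b \<le> b'\<close> by (cases j) auto
    then have "b = (b' + i * q) + q" using j by simp
    moreover have "b' + i * q \<in> S2" using ab' q_mem B.mult_mem B.add_mem by blast
    ultimately show False using apery by blast
  qed
  then obtain j where j: "b' = b + j * q" "a = a' + j * p"
    using representation_shift[OF ab'(3)] by blast
  have "int (B.ord b') \<le> int (B.ord b) + int j * (int (B.ord q) + l_sg S2 q)"
    unfolding j(1) by (rule B.ord_add_mult_le_l[OF b q_mem])
  also have "\<dots> \<le> int (B.ord b) + int j * int (A.ord p)"
    using specific by (intro add_left_mono mult_left_mono) auto
  finally have "int (B.ord b') \<le> int (B.ord b + j * A.ord p)" by simp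
  then have "B.ord b' \<le> B.ord b + j * A.ord p" by (simp only: of_nat_le_iff)
  moreover have "A.ord a' + j * A.ord p \<le> A.ord a"
    unfolding j(2) by (rule A.ord_mult_superadd[OF p_mem ab'(1)])
  ultimately show "C.ord (q * a + p * b) \<le> A.ord a + B.ord b" using le by linarith
qed (rule ord_S_ge[OF a b])

text \<open>Evaluate the bound on the growth of the order at \<open>e(S2)\<close> copies of \<open>q\<close>, whose sum has order \<open>q\<close>:
  this gives \<open>q \<le> e(S2) * ord p\<close>. Since \<open>p\<close> is at least \<open>e(S1) * ord p\<close>, the generator
  \<open>q * e(S1)\<close> is the smaller of the two candidates for the multiplicity of \<open>S\<close>.\<close>

lemma multiplicity_le: "q * A.e \<le> p * B.e"
proof -
  have "B.e * q \<in> S2" using q_mem B.mult_mem by blast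
  have "q \<le> B.ord (q * B.e)" by (simp add: B.ord_multiple_e)
  then have "int q \<le> int (B.ord (0 + B.e * q))" by (simp add: mult.commute)
  also have "\<dots> \<le> int (B.ord 0) + int B.e * (int (B.ord q) + l_sg S2 q)"
    by (rule B.ord_add_mult_le_l[OF B.zero_mem q_mem])
  also have "\<dots> \<le> int B.e * int (A.ord p)"
    using specific by (simp add: mult_left_mono)
  finally have "int q \<le> int (B.e * A.ord p)" by simp
  then have "q \<le> B.e * A.ord p" by (simp only: of_nat_le_iff)
  then have "q * A.e \<le> B.e * A.ord p * A.e" by (rule mult_le_mono1)
  also have "\<dots> \<le> B.e * p" using A.ord_e_le[OF p_mem] by (simp add: mult.assoc)
  finally show ?thesis by (simp add: mult.commute)
qed

lemma multiplicity_S: "C.e = q * A.e"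
proof (rule antisym)
  have "q * A.e \<in> max_part S" using S_I[OF A.e_in B.zero_mem] A.e_pos q_pos by simp
  then show "C.e \<le> q * A.e" by (rule C.e_le)
  obtain a b where ab: "a \<in> S1" "b \<in> S2" "C.e = q * a + p * b" using C.e_in by (auto simp: S_def)
  show "q * A.e \<le> C.e"
  proof (cases "a = 0")
    case True
    then have "b \<noteq> 0" using ab(3) C.e_pos by auto
    then have "B.e \<le> b" using B.e_le ab(2) by simp
    then have "p * B.e \<le> p * b" by simp
    then show ?thesis using multiplicity_le ab(3) by linarith
  next
    case False
    then have "A.e \<le> a" using A.e_le ab(1) by simp
    then show ?thesis using ab(3) by (simp add: trans_le_add1)
  qed
qed

theorem ord_regular_S_iff: "C.ord_regular \<longleftrightarrow> A.ord_regular"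
proof
  have apery0: "\<forall>b'\<in>S2. 0 \<noteq> b' + q" using q_pos by simp
  assume C: "C.ord_regular"
  show "A.ord_regular" unfolding A.ord_regular_def
  proof
    fix a assume a: "a \<in> S1"
    have "C.ord (q * a + p * 0 + C.e) = Suc (C.ord (q * a + p * 0))"
      using C S_I[OF a B.zero_mem] unfolding C.ord_regular_def by blast
    then have "C.ord (q * (a + A.e) + p * 0) = Suc (C.ord (q * a + p * 0))"
      by (simp add: multiplicity_S algebra_simps)
    then show "A.ord (a + A.e) = Suc (A.ord a)"
      using ord_S_apery[OF a B.zero_mem apery0]
        ord_S_apery[OF A.add_mem[OF a A.e_in] B.zero_mem apery0] by simp
  qed
next
  assume A: "A.ord_regular"
  show "C.ord_regular" unfolding C.ord_regular_def
  proof
    fix s assume "s \<in> S"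
    then obtain a b where ab: "a \<in> S1" "b \<in> S2" "s = q * a + p * b" "\<forall>b'\<in>S2. b \<noteq> b' + q"
      using apery_representation by blast
    have "s + C.e = q * (a + A.e) + p * b" by (simp add: ab(3) multiplicity_S algebra_simps)
    then have "C.ord (s + C.e) = A.ord (a + A.e) + B.ord b"
      using ord_S_apery[OF A.add_mem[OF ab(1) A.e_in] ab(2,4)] by simp
    also have "A.ord (a + A.e) = Suc (A.ord a)" using A ab(1) by (simp add: A.ord_regular_def)
    finally show "C.ord (s + C.e) = Suc (C.ord s)" using ord_S_apery[OF ab(1,2,4)] ab(3) by simp
  qed
qed

end

section \<open>Ideals of the polynomial ring and radicals\<close>

text \<open>Division with remainder by a nonzero element of least size. The set is described by closure
  conditions because it arises as the trace on \<open>K[x]\<close> of an ideal of another ring.\<close>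

lemma polynomial_ideal_principal:
  fixes D :: "'k::field poly set"
  assumes zero: "0 \<in> D" and add: "\<And>f g. f \<in> D \<Longrightarrow> g \<in> D \<Longrightarrow> f + g \<in> D"
    and mult: "\<And>f g. g \<in> D \<Longrightarrow> f * g \<in> D"
  shows "\<exists>d\<in>D. \<forall>f\<in>D. d dvd f"
proof (cases "D \<subseteq> {0}")
  case True
  then show ?thesis using zero by auto
next
  case False
  then obtain d0 where "d0 \<in> D - {0}" by auto
  then obtain d where d: "d \<in> D - {0}" "\<And>f. f \<in> D - {0} \<Longrightarrow> euclidean_size d \<le> euclidean_size f"
    using ex_has_least_nat[of "\<lambda>f. f \<in> D - {0}" d0 euclidean_size] by blast
  have "d dvd f" if "f \<in> D" for f
  proof -
    have "f mod d = f + (- (f div d)) * d" by (simp add: minus_div_mult_eq_mod[symmetric])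
    then have "f mod d \<in> D" using add[OF that mult[of d "- (f div d)"]] d(1) by simp
    moreover have "euclidean_size (f mod d) < euclidean_size d" using mod_size_less d(1) by blast
    ultimately have "f mod d = 0" using d(2)[of "f mod d"] by force
    then show ?thesis by (simp add: mod_eq_0_iff_dvd)
  qed
  then show ?thesis using d(1) by blast
qed

definition radical :: "('a, 'b) ring_scheme \<Rightarrow> 'a set \<Rightarrow> 'a set" where
  "radical R I = {x \<in> carrier R. \<exists>k::nat. x [^]\<^bsub>R\<^esub> k \<in> I}"

context cring
begin

lemma idealI_closed:
  assumes "I \<subseteq> carrier R" "\<zero> \<in> I" "\<And>x y. x \<in> I \<Longrightarrow> y \<in> I \<Longrightarrow> x \<oplus> y \<in> I"
    and mult: "\<And>x y. x \<in> I \<Longrightarrow> y \<in> carrier R \<Longrightarrow> y \<otimes> x \<in> I"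
  shows "ideal I R"
proof (rule idealI[OF ring_axioms])
  have "\<ominus> x \<in> I" if "x \<in> I" for x
  proof -
    have "\<ominus> x = (\<ominus> \<one>) \<otimes> x" using that assms(1) by (auto simp: l_minus)
    then show ?thesis using mult[OF that, of "\<ominus> \<one>"] by simp
  qed
  then show "subgroup I (add_monoid R)"
    using assms(1-3) by (intro add.subgroupI) (auto simp flip: a_inv_def)
  show "x \<otimes> a \<in> I" "a \<otimes> x \<in> I" if "a \<in> I" "x \<in> carrier R" for a x
    using mult[OF that] m_comm[of a x] assms(1) that by auto
qed

lemma ideal_add_mem: "ideal I R \<Longrightarrow> x \<in> I \<Longrightarrow> y \<in> I \<Longrightarrow> x \<oplus> y \<in> I"
  by (simp add: additive_subgroup.a_closed ideal.axioms(1))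

lemma ideal_zero_mem: "ideal I R \<Longrightarrow> \<zero> \<in> I"
  by (simp add: additive_subgroup.zero_closed ideal.axioms(1))

lemma ideal_add_cancel:
  assumes "ideal I R" "x \<in> carrier R" "x \<oplus> y \<in> I" "y \<in> I"
  shows "x \<in> I"
proof -
  have y: "y \<in> carrier R" using assms(1,4) by (rule ideal.Icarr)
  have "\<ominus> y \<in> I" using assms(1,4) by (simp add: additive_subgroup.a_inv_closed ideal.axioms(1))
  then have "(x \<oplus> y) \<oplus> (\<ominus> y) \<in> I" using assms(1,3) ideal_add_mem by blast
  then show ?thesis using assms(2) y by (simp add: a_assoc r_neg)
qed

lemma genideal_empty: "Idl {} = {\<zero>}"
  using genideal_minimal[OF zeroideal, of "{}"] ideal_zero_mem[OF genideal_ideal[of "{}"]] by auto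

text \<open>This part of the binomial theorem is all that is needed to show that radicals are closed under
  addition.\<close>

lemma pow_add_expand:
  assumes "x \<in> carrier R" "y \<in> carrier R"
  shows "\<exists>c\<in>carrier R. (x \<oplus> y) [^] (k::nat) = x \<otimes> c \<oplus> y [^] k"
proof (induction k)
  case 0 show ?case by (rule bexI[of _ \<zero>]) (use assms in auto)
next
  case (Suc k)
  then obtain c where c: "c \<in> carrier R" "(x \<oplus> y) [^] k = x \<otimes> c \<oplus> y [^] k" by blast
  define z where "z = y [^] k"
  have z: "z \<in> carrier R" using assms by (simp add: z_def)
  have "(x \<oplus> y) [^] Suc k = (x \<otimes> c \<oplus> z) \<otimes> (x \<oplus> y)" by (simp add: c(2) z_def)
  also have "\<dots> = x \<otimes> (c \<otimes> (x \<oplus> y) \<oplus> z) \<oplus> z \<otimes> y" using assms c(1) z by algebra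
  finally show ?case using assms c(1) z by (intro bexI[of _ "c \<otimes> (x \<oplus> y) \<oplus> z"]) (auto simp: z_def)
qed

lemma radicalI: "x \<in> carrier R \<Longrightarrow> x [^] (k::nat) \<in> I \<Longrightarrow> x \<in> radical R I"
  unfolding radical_def by blast

lemma radical_superset: assumes "ideal I R" shows "I \<subseteq> radical R I"
proof
  fix x assume "x \<in> I"
  then have "x \<in> carrier R" by (rule ideal.Icarr[OF assms])
  then show "x \<in> radical R I" using \<open>x \<in> I\<close> radicalI[of x 1 I] by simp
qed

lemma radical_ideal: assumes I: "ideal I R" shows "ideal (radical R I) R"
proof (rule idealI_closed)
  show "radical R I \<subseteq> carrier R" by (auto simp: radical_def)
  show "\<zero> \<in> radical R I" using radical_superset[OF I] ideal_zero_mem[OF I] by blast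
next
  fix x y assume "x \<in> radical R I" and y: "y \<in> carrier R"
  then obtain k :: nat where k: "x \<in> carrier R" "x [^] k \<in> I" by (auto simp: radical_def)
  have "(y \<otimes> x) [^] k = y [^] k \<otimes> x [^] k" using k y by (simp add: nat_pow_distrib)
  also have "\<dots> \<in> I" using ideal.I_l_closed[OF I k(2)] y by simp
  finally show "y \<otimes> x \<in> radical R I" using radicalI k y by blast
next
  fix x y assume "x \<in> radical R I" "y \<in> radical R I"
  then obtain k l :: nat where k: "x \<in> carrier R" "x [^] k \<in> I" and l: "y \<in> carrier R" "y [^] l \<in> I"
    by (auto simp: radical_def)
  obtain c where c: "c \<in> carrier R" "(x \<oplus> y) [^] l = x \<otimes> c \<oplus> y [^] l"
    using pow_add_expand[OF k(1) l(1)] by blast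
  obtain c' where c': "c' \<in> carrier R" "(y [^] l \<oplus> x \<otimes> c) [^] k = y [^] l \<otimes> c' \<oplus> (x \<otimes> c) [^] k"
    using pow_add_expand[of "y [^] l" "x \<otimes> c" k] k l c by auto
  have "(x \<oplus> y) [^] (l * k) = ((x \<oplus> y) [^] l) [^] k" using k l by (simp add: nat_pow_pow)
  also have "\<dots> = (y [^] l \<oplus> x \<otimes> c) [^] k" using c k l by (simp add: a_comm)
  also have "\<dots> = y [^] l \<otimes> c' \<oplus> x [^] k \<otimes> c [^] k" using c' k c by (simp add: nat_pow_distrib)
  also have "\<dots> \<in> I" using ideal.I_r_closed[OF I] k l c c' by (intro ideal_add_mem[OF I]) auto
  finally show "x \<oplus> y \<in> radical R I" using radicalI k l by blast
qed

lemma radical_mono: "I \<subseteq> J \<Longrightarrow> radical R I \<subseteq> radical R J"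
  by (auto simp: radical_def)

lemma radical_prime: assumes "primeideal P R" shows "radical R P = P"
proof
  interpret P: primeideal P R by fact
  show "P \<subseteq> radical R P" by (rule radical_superset[OF P.is_ideal])
  have "x \<in> P" if "x [^] (k::nat) \<in> P" "x \<in> carrier R" for x k
    using that
  proof (induction k)
    case 0 then show ?case using P.one_imp_carrier P.I_notcarr by auto
  next
    case (Suc k) then show ?case using P.I_prime[of "x [^] k" x] by auto
  qed
  then show "radical R P \<subseteq> P" by (auto simp: radical_def)
qed

lemma nonzerodivisor_pow:
  assumes "ideal I R" "x \<in> carrier R" "\<And>y. y \<in> carrier R \<Longrightarrow> x \<otimes> y \<in> I \<Longrightarrow> y \<in> I"
    and "y \<in> carrier R" "x [^] (k::nat) \<otimes> y \<in> I"
  shows "y \<in> I"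
  using assms(4,5)
proof (induction k arbitrary: y)
  case (Suc k)
  have "x [^] k \<otimes> (x \<otimes> y) \<in> I" using Suc.prems assms(2) by (simp add: m_assoc)
  then have "x \<otimes> y \<in> I" using Suc.IH[of "x \<otimes> y"] Suc.prems assms(2) by simp
  then show ?case using assms(3) Suc.prems by blast
qed simp

end

section \<open>Algebras over a polynomial ring in one variable\<close>

text \<open>The submodule generated by a list; recursion on the list permits induction on the number of
  generators.\<close>

fun module_span :: "('a, 'b) ring_scheme \<Rightarrow> ('c \<Rightarrow> 'a) \<Rightarrow> 'a list \<Rightarrow> 'a set" where
  "module_span R \<phi> [] = {\<zero>\<^bsub>R\<^esub>}"
| "module_span R \<phi> (w # ws) = {\<phi> f \<otimes>\<^bsub>R\<^esub> w \<oplus>\<^bsub>R\<^esub> y | f y. y \<in> module_span R \<phi> ws}"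

locale polynomial_algebra = cring R for R :: "('a, 'b) ring_scheme" (structure) +
  fixes \<phi> :: "'k::field poly \<Rightarrow> 'a"
  assumes phi_closed [simp, intro]: "\<phi> f \<in> carrier R"
    and phi_add: "\<phi> (f + g) = \<phi> f \<oplus> \<phi> g"
    and phi_mult: "\<phi> (f * g) = \<phi> f \<otimes> \<phi> g"
    and phi_one: "\<phi> 1 = \<one>"
begin

lemma phi_zero: "\<phi> 0 = \<zero>"
  using phi_add[of 0 0] phi_closed[of 0] by (metis add.l_cancel_one' add_0)

lemma phi_pow: "\<phi> (f ^ k) = \<phi> f [^] (k::nat)"
  by (induction k) (simp_all add: phi_one phi_mult m_comm)

lemma phi_uminus: "\<phi> (- f) = \<ominus> \<phi> f"
proof -
  have "\<phi> (- f) \<oplus> \<phi> f = \<zero>" using phi_add[of "- f" f] by (simp add: phi_zero)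
  then show ?thesis by (simp add: minus_equality)
qed

lemma module_span_closed: "set ws \<subseteq> carrier R \<Longrightarrow> module_span R \<phi> ws \<subseteq> carrier R"
  by (induction ws) auto

lemma module_spanI: "y \<in> module_span R \<phi> ws \<Longrightarrow> \<phi> f \<otimes> w \<oplus> y \<in> module_span R \<phi> (w # ws)"
  by auto

lemma module_span_zero: "set ws \<subseteq> carrier R \<Longrightarrow> \<zero> \<in> module_span R \<phi> ws"
proof (induction ws)
  case (Cons w ws)
  then have "\<zero> = \<phi> 0 \<otimes> w \<oplus> \<zero>" "\<zero> \<in> module_span R \<phi> ws" by (auto simp: phi_zero)
  then show ?case by auto
qed simp

lemma module_span_add:
  "set ws \<subseteq> carrier R \<Longrightarrow> x \<in> module_span R \<phi> ws \<Longrightarrow> y \<in> module_span R \<phi> ws \<Longrightarrow> x \<oplus> y \<in> module_span R \<phi> ws"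
proof (induction ws arbitrary: x y)
  case (Cons w ws)
  obtain f x' where x: "x = \<phi> f \<otimes> w \<oplus> x'" "x' \<in> module_span R \<phi> ws" using Cons.prems(2) by auto
  obtain g y' where y: "y = \<phi> g \<otimes> w \<oplus> y'" "y' \<in> module_span R \<phi> ws" using Cons.prems(3) by auto
  have "x' \<in> carrier R" "y' \<in> carrier R" "w \<in> carrier R"
    using module_span_closed[of ws] x y Cons.prems(1) by auto
  moreover have "\<phi> f \<in> carrier R" "\<phi> g \<in> carrier R" by auto
  ultimately have "x \<oplus> y = (\<phi> f \<oplus> \<phi> g) \<otimes> w \<oplus> (x' \<oplus> y')" unfolding x y by algebra
  then have "x \<oplus> y = \<phi> (f + g) \<otimes> w \<oplus> (x' \<oplus> y')" by (simp add: phi_add)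
  moreover have "x' \<oplus> y' \<in> module_span R \<phi> ws" using Cons x y by simp
  ultimately show ?case by auto
qed simp

lemma module_span_mult:
  "set ws \<subseteq> carrier R \<Longrightarrow> x \<in> module_span R \<phi> ws \<Longrightarrow> \<phi> g \<otimes> x \<in> module_span R \<phi> ws"
proof (induction ws arbitrary: x)
  case (Cons w ws)
  obtain f x' where x: "x = \<phi> f \<otimes> w \<oplus> x'" "x' \<in> module_span R \<phi> ws" using Cons.prems(2) by auto
  have "x' \<in> carrier R" "w \<in> carrier R"
    using module_span_closed[of ws] x Cons.prems(1) by auto
  then have "\<phi> g \<otimes> x = \<phi> (g * f) \<otimes> w \<oplus> \<phi> g \<otimes> x'" 
    unfolding x by (simp add: phi_mult r_distr m_assoc)
  moreover have "\<phi> g \<otimes> x' \<in> module_span R \<phi> ws" using Cons x by simp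
  ultimately show ?case by auto
qed simp

lemma module_span_mem:
  "set ws \<subseteq> carrier R \<Longrightarrow> w \<in> set ws \<Longrightarrow> w \<in> module_span R \<phi> ws"
proof (induction ws)
  case (Cons v ws)
  have v: "v \<in> carrier R" using Cons.prems by simp
  show ?case
  proof (cases "w = v")
    case True
    have "\<phi> 1 \<otimes> v \<oplus> \<zero> \<in> module_span R \<phi> (v # ws)"
      by (rule module_spanI) (use module_span_zero[of ws] Cons.prems(1) in simp)
    then show ?thesis using True v by (simp add: phi_one del: module_span.simps)
  next
    case False
    then have w: "w \<in> module_span R \<phi> ws" "w \<in> carrier R" using Cons.IH Cons.prems by auto
    have "\<phi> 0 \<otimes> v \<oplus> w \<in> module_span R \<phi> (v # ws)" by (rule module_spanI[OF w(1)])
    then show ?thesis using v w(2) by (simp add: phi_zero del: module_span.simps)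
  qed
qed simp

text \<open>Submodules of finitely generated modules over \<open>K[x]\<close> are finitely generated, by induction on the
  number of generators: the coefficients of the first generator \<open>w\<close> form a principal ideal, and an
  element \<open>j0\<close> that realizes its generator \<open>d\<close> can be used to clear the coefficient of \<open>w\<close>. The
  conclusion speaks of the ideals of the ring, since this is what the Noetherian property asks for.\<close>

lemma submodule_finitely_generated:
  assumes "set ws \<subseteq> carrier R" "J \<subseteq> module_span R \<phi> ws" "\<zero> \<in> J"
    and add: "\<And>x y. x \<in> J \<Longrightarrow> y \<in> J \<Longrightarrow> x \<oplus> y \<in> J"
    and mult: "\<And>f x. x \<in> J \<Longrightarrow> \<phi> f \<otimes> x \<in> J"
  shows "\<exists>A\<subseteq>J. finite A \<and> (\<forall>I. ideal I R \<and> A \<subseteq> I \<longrightarrow> J \<subseteq> I)"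
  using assms
proof (induction ws arbitrary: J)
  case Nil
  then have "J = {\<zero>}" by auto
  then show ?case using ideal_zero_mem by (intro exI[of _ "{}"]) auto
next
  case (Cons w ws)
  have w: "w \<in> carrier R" and ws: "set ws \<subseteq> carrier R" using Cons.prems(1) by auto
  have span: "module_span R \<phi> ws \<subseteq> carrier R" using module_span_closed[OF ws] .
  define D where "D = {f. \<exists>y\<in>module_span R \<phi> ws. \<phi> f \<otimes> w \<oplus> y \<in> J}"
  have "0 \<in> D"
    using Cons.prems(3) module_span_zero[OF ws] w unfolding D_def by (auto simp: phi_zero intro!: bexI[of _ \<zero>])
  moreover have "f + g \<in> D" if fg: "f \<in> D" "g \<in> D" for f g
  proof -
    obtain x where x: "x \<in> module_span R \<phi> ws" "\<phi> f \<otimes> w \<oplus> x \<in> J" using fg(1) by (auto simp: D_def)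
    obtain y where y: "y \<in> module_span R \<phi> ws" "\<phi> g \<otimes> w \<oplus> y \<in> J" using fg(2) by (auto simp: D_def)
    have "x \<in> carrier R" "y \<in> carrier R" "\<phi> f \<in> carrier R" "\<phi> g \<in> carrier R" using x y span by auto
    then have "(\<phi> f \<otimes> w \<oplus> x) \<oplus> (\<phi> g \<otimes> w \<oplus> y) = (\<phi> f \<oplus> \<phi> g) \<otimes> w \<oplus> (x \<oplus> y)"
      using w by algebra
    then have "\<phi> (f + g) \<otimes> w \<oplus> (x \<oplus> y) \<in> J" using Cons.prems(4)[OF x(2) y(2)] by (simp add: phi_add)
    then show ?thesis using module_span_add[OF ws x(1) y(1)] by (auto simp: D_def)
  qed
  moreover have "f * g \<in> D" if g: "g \<in> D" for f g
  proof -
    obtain y where y: "y \<in> module_span R \<phi> ws" "\<phi> g \<otimes> w \<oplus> y \<in> J" using g by (auto simp: D_def)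
    have "y \<in> carrier R" using y span by auto
    then have "\<phi> f \<otimes> (\<phi> g \<otimes> w \<oplus> y) = \<phi> (f * g) \<otimes> w \<oplus> \<phi> f \<otimes> y"
      using w by (simp add: phi_mult r_distr m_assoc)
    then have "\<phi> (f * g) \<otimes> w \<oplus> \<phi> f \<otimes> y \<in> J" using Cons.prems(5)[OF y(2), of f] by simp
    then show ?thesis using module_span_mult[OF ws y(1)] by (auto simp: D_def)
  qed
  ultimately have "\<exists>d\<in>D. \<forall>f\<in>D. d dvd f"
    by (rule polynomial_ideal_principal)
  then obtain d where d: "d \<in> D" "\<And>f. f \<in> D \<Longrightarrow> d dvd f" by blast
  obtain y0 where y0: "y0 \<in> module_span R \<phi> ws" "\<phi> d \<otimes> w \<oplus> y0 \<in> J"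
    using d(1) unfolding D_def by blast
  define j0 where "j0 = \<phi> d \<otimes> w \<oplus> y0"
  have y0c: "y0 \<in> carrier R" using y0 span by auto
  have j0: "j0 \<in> J" "j0 \<in> carrier R" using y0 y0c w by (auto simp: j0_def)
  define J' where "J' = J \<inter> module_span R \<phi> ws"
  have "\<exists>A\<subseteq>J'. finite A \<and> (\<forall>I. ideal I R \<and> A \<subseteq> I \<longrightarrow> J' \<subseteq> I)"
    by (rule Cons.IH[OF ws])
      (use Cons.prems module_span_zero[OF ws] module_span_add[OF ws] module_span_mult[OF ws] in
        \<open>auto simp: J'_def\<close>)
  then obtain A where A: "A \<subseteq> J'" "finite A" "\<And>I. ideal I R \<Longrightarrow> A \<subseteq> I \<Longrightarrow> J' \<subseteq> I" by blast
  have "J \<subseteq> I" if I: "ideal I R" "insert j0 A \<subseteq> I" for I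
  proof
    fix x assume x: "x \<in> J"
    then obtain f y where fy: "x = \<phi> f \<otimes> w \<oplus> y" "y \<in> module_span R \<phi> ws" using Cons.prems(2) by auto
    then have "f \<in> D" using x by (auto simp: D_def)
    then obtain h where h: "f = d * h" using d(2) by (auto simp: dvd_def)
    have yc: "y \<in> carrier R" using fy span by auto
    then have xc: "x \<in> carrier R" using fy w by simp
    define z where "z = x \<oplus> \<phi> (- h) \<otimes> j0"
    have "\<phi> (- h) \<otimes> j0 = \<phi> (- f) \<otimes> w \<oplus> \<phi> (- h) \<otimes> y0"
      using w y0c unfolding j0_def h by (simp add: r_distr flip: m_assoc phi_mult) (simp add: mult.commute)
    moreover have "\<phi> f \<in> carrier R" "\<phi> (- h) \<in> carrier R" by auto
    ultimately have "z = y \<oplus> \<phi> (- h) \<otimes> y0"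
      using w y0c yc unfolding z_def fy phi_uminus[of f] by algebra
    then have "z \<in> module_span R \<phi> ws" using fy y0 module_span_add[OF ws] module_span_mult[OF ws] by simp
    moreover have "z \<in> J" unfolding z_def using Cons.prems(4,5) x j0(1) by blast
    ultimately have "z \<in> I" using A(3)[OF I(1)] I(2) by (auto simp: J'_def)
    moreover have "\<phi> (- h) \<otimes> j0 \<in> I" using I ideal.I_l_closed[OF I(1)] by simp
    ultimately show "x \<in> I" using ideal_add_cancel[OF I(1) xc] by (simp add: z_def)
  qed
  then show ?case using A(1,2) j0(1) by (intro exI[of _ "insert j0 A"]) (auto simp: J'_def)
qed

lemma phi_preimage_principal:
  assumes "ideal I R"
  obtains d where "\<phi> d \<in> I" "\<And>f. \<phi> f \<in> I \<Longrightarrow> d dvd f"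
proof -
  have "\<exists>d\<in>{f. \<phi> f \<in> I}. \<forall>f\<in>{f. \<phi> f \<in> I}. d dvd f"
    by (rule polynomial_ideal_principal[of "{f. \<phi> f \<in> I}"])
      (use assms in \<open>auto simp: phi_zero phi_add phi_mult ideal_zero_mem ideal_add_mem ideal.I_l_closed\<close>)
  then show thesis using that by auto
qed

lemma phi_preimage_dvd: "ideal I R \<Longrightarrow> \<phi> d \<in> I \<Longrightarrow> d dvd f \<Longrightarrow> \<phi> f \<in> I"
  by (auto simp: dvd_def phi_mult ideal.I_r_closed)

end

section \<open>Nilpotent extensions of a polynomial ring\<close>

text \<open>A finitely generated algebra over \<open>K[x]\<close> in which \<open>K[x]\<close> embeds and all module generators
  other than \<open>1\<close> are nilpotent. The image of \<open>K[x]\<close> then is a complement of the nilradical \<open>N\<close>.\<close>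

locale nilpotent_extension = polynomial_algebra R \<phi>
  for R :: "('a, 'b) ring_scheme" (structure) and \<phi> :: "'k::field poly \<Rightarrow> 'a" +
  fixes ws :: "'a list"
  assumes phi_inj: "\<phi> f = \<zero> \<Longrightarrow> f = 0"
    and ws_closed: "set ws \<subseteq> carrier R"
    and ws_nilpotent: "w \<in> set ws \<Longrightarrow> \<exists>k::nat. w [^] k = \<zero>"
    and spanning: "carrier R \<subseteq> module_span R \<phi> (\<one> # ws)"
begin

definition N :: "'a set" where "N = radical R {\<zero>}"

lemma ideal_N: "ideal N R"
  unfolding N_def by (rule radical_ideal[OF zeroideal])

lemma N_subset_radical: "ideal I R \<Longrightarrow> N \<subseteq> radical R I"
  unfolding N_def by (rule radical_mono) (auto simp: ideal_zero_mem)

lemma N_subset_prime: "primeideal P R \<Longrightarrow> N \<subseteq> P"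
  using N_subset_radical[of P] radical_prime[of P] primeideal.axioms(1)[of P R] by auto

lemma ws_subset_N: "set ws \<subseteq> N"
  using ws_closed ws_nilpotent by (auto simp: N_def radical_def)

lemma span_ws_subset: assumes "ideal I R" "set ws \<subseteq> I" shows "module_span R \<phi> ws \<subseteq> I"
  using assms(2)
proof (induction ws)
  case (Cons w ws)
  show ?case
  proof
    fix x assume "x \<in> module_span R \<phi> (w # ws)"
    then obtain f y where "x = \<phi> f \<otimes> w \<oplus> y" "y \<in> module_span R \<phi> ws" by auto
    then show "x \<in> I"
      using Cons ideal_add_mem[OF assms(1)] ideal.I_l_closed[OF assms(1), of w "\<phi> f"] by auto
  qed
qed (simp add: ideal_zero_mem[OF assms(1)])

lemma decomposition_span:
  assumes "x \<in> carrier R"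
  obtains f n where "n \<in> module_span R \<phi> ws" "n \<in> carrier R" "x = \<phi> f \<oplus> n"
proof -
  obtain f n where "x = \<phi> f \<otimes> \<one> \<oplus> n" "n \<in> module_span R \<phi> ws" using spanning assms by auto
  then show thesis using that[of n f] module_span_closed[OF ws_closed] by auto
qed

lemma decomposition:
  assumes "x \<in> carrier R"
  obtains f n where "n \<in> N" "n \<in> carrier R" "x = \<phi> f \<oplus> n"
proof -
  obtain f n where "n \<in> module_span R \<phi> ws" "n \<in> carrier R" "x = \<phi> f \<oplus> n"
    using decomposition_span[OF assms] .
  then show thesis using that[of n f] span_ws_subset[OF ideal_N ws_subset_N] by auto
qed

lemma phi_mem_N: assumes "\<phi> f \<in> N" shows "f = 0"
proof -
  obtain k :: nat where "\<phi> f [^] k = \<zero>" using assms by (auto simp: N_def radical_def)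
  then have "\<phi> (f ^ k) = \<zero>" by (simp add: phi_pow)
  then have "f ^ k = 0" by (rule phi_inj)
  then show ?thesis by simp
qed

lemma one_not_zero: "\<one> \<noteq> \<zero>"
  using phi_inj[of 1] by (auto simp: phi_one)

text \<open>The quotient by \<open>N\<close> is \<open>K[x]\<close>, an integral domain.\<close>

lemma primeideal_N: "primeideal N R"
proof (rule primeidealI[OF ideal_N is_cring])
  have "\<one> \<notin> N" using phi_mem_N[of 1] by (auto simp: phi_one)
  then show "carrier R \<noteq> N" by auto
next
  fix x y assume x: "x \<in> carrier R" and y: "y \<in> carrier R" and xy: "x \<otimes> y \<in> N"
  obtain f n where n: "n \<in> N" "n \<in> carrier R" "x = \<phi> f \<oplus> n" using decomposition[OF x] .
  obtain g m where m: "m \<in> N" "m \<in> carrier R" "y = \<phi> g \<oplus> m" using decomposition[OF y] .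
  have "x \<otimes> y = \<phi> f \<otimes> \<phi> g \<oplus> (\<phi> f \<otimes> m \<oplus> n \<otimes> \<phi> g \<oplus> n \<otimes> m)"
    unfolding n m using n(2) m(2) phi_closed[of f] phi_closed[of g] by algebra
  moreover have "\<phi> f \<otimes> m \<oplus> n \<otimes> \<phi> g \<oplus> n \<otimes> m \<in> N"
    using n m ideal_N ideal.I_l_closed[OF ideal_N] ideal.I_r_closed[OF ideal_N]
    by (auto intro!: ideal_add_mem)
  ultimately have "\<phi> (f * g) \<in> N" using ideal_add_cancel[OF ideal_N] xy by (simp add: phi_mult)
  then have "f * g = 0" by (rule phi_mem_N)
  then show "x \<in> N \<or> y \<in> N" using n m by (auto simp: phi_zero)
qed

text \<open>Otherwise \<open>x\<close> would be invertible modulo \<open>N\<close>, hence in \<open>K[x]\<close>.\<close>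

lemma N_not_maximal: "\<not> maximalideal N R"
proof
  assume "maximalideal N R"
  then interpret N: maximalideal N R .
  define \<xi> :: "'k poly" where "\<xi> = [:0, 1:]"
  define J where "J = set_add R N (PIdl (\<phi> \<xi>))"
  have J: "ideal J R" unfolding J_def by (intro add_ideals ideal_N cgenideal_ideal) auto
  have mem: "m \<oplus> z \<otimes> \<phi> \<xi> \<in> J" if "m \<in> N" "z \<in> carrier R" for m z
    unfolding J_def set_add_def' cgenideal_def using that by blast
  have "N \<subseteq> J"
    using mem[of _ \<zero>] ideal.Icarr[OF ideal_N] by force
  moreover have "\<phi> \<xi> \<in> J" using mem[of \<zero> \<one>] ideal_zero_mem[OF ideal_N] by simp
  moreover have "\<phi> \<xi> \<notin> N" using phi_mem_N[of \<xi>] by (auto simp: \<xi>_def)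
  ultimately have "J = carrier R" using N.I_maximal[OF J] ideal.Icarr[OF J] by blast
  then have "\<one> \<in> J" by simp
  then obtain m z where mz: "m \<in> N" "z \<in> carrier R" "\<one> = m \<oplus> z \<otimes> \<phi> \<xi>"
    unfolding J_def set_add_def' cgenideal_def by blast
  obtain g n where n: "n \<in> N" "n \<in> carrier R" "z = \<phi> g \<oplus> n" using decomposition[OF mz(2)] .
  have m: "m \<in> carrier R" using mz ideal.Icarr[OF ideal_N] by blast
  have "\<phi> (1 + - (g * \<xi>)) = \<phi> 1 \<oplus> \<ominus> (\<phi> g \<otimes> \<phi> \<xi>)" by (simp only: phi_add phi_uminus phi_mult)
  also have "\<dots> = m \<oplus> n \<otimes> \<phi> \<xi>"
    unfolding phi_one mz(3) n(3) using m n(2) phi_closed[of g] phi_closed[of \<xi>] by algebra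
  also have "\<dots> \<in> N" using mz n ideal_add_mem[OF ideal_N] ideal.I_r_closed[OF ideal_N] by simp
  finally have "1 + - (g * \<xi>) = 0" by (rule phi_mem_N)
  then have "poly (1 + - (g * \<xi>)) 0 = 0" by simp
  then show False by (simp add: \<xi>_def)
qed

text \<open>All prime ideals contain \<open>N\<close>, so they are determined by their traces on \<open>K[x]\<close>. The upper two traces
  are generated by polynomials \<open>d\<close> and \<open>d'\<close> with \<open>d = d' * c\<close> nonzero. As the smaller ideal is prime,
  one of \<open>d'\<close> and \<open>c\<close> belongs to it. In the first case the upper two ideals agree; in the second
  case \<open>d'\<close> is a unit.\<close>

lemma prime_chain_length:
  assumes "primeideal P0 R" "primeideal P1 R" "primeideal P2 R" "P0 \<subset> P1" "P1 \<subset> P2"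
  shows False
proof -
  interpret P1: primeideal P1 R by fact
  interpret P2: primeideal P2 R by fact
  obtain x where x: "x \<in> P1" "x \<notin> P0" using assms by blast
  obtain f n where n: "n \<in> N" "n \<in> carrier R" "x = \<phi> f \<oplus> n"
    using decomposition[OF P1.Icarr[OF x(1)]] .
  have "n \<in> P0" using n N_subset_prime assms(1) by blast
  have "f \<noteq> 0" using x(2) n \<open>n \<in> P0\<close> by (auto simp: phi_zero)
  have "\<phi> f \<in> P1" 
    using ideal_add_cancel[OF P1.is_ideal, of "\<phi> f" n] x(1) n(3) \<open>n \<in> P0\<close> assms(4) by auto
  obtain d where d: "\<phi> d \<in> P1" "\<And>f. \<phi> f \<in> P1 \<Longrightarrow> d dvd f"
    using phi_preimage_principal[OF P1.is_ideal] by blast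
  obtain d' where d': "\<phi> d' \<in> P2" "\<And>f. \<phi> f \<in> P2 \<Longrightarrow> d' dvd f"
    using phi_preimage_principal[OF P2.is_ideal] by blast
  have "d \<noteq> 0" using d(2)[OF \<open>\<phi> f \<in> P1\<close>] \<open>f \<noteq> 0\<close> by auto
  obtain c where c: "d = d' * c" using d'(2)[of d] d(1) assms(5) by (auto simp: dvd_def)
  then have "\<phi> d' \<in> P1 \<or> \<phi> c \<in> P1" using P1.I_prime[of "\<phi> d'" "\<phi> c"] d(1) by (simp add: phi_mult)
  then show False
  proof
    assume d'P1: "\<phi> d' \<in> P1"
    have "P2 \<subseteq> P1"
    proof
      fix y assume y: "y \<in> P2"
      obtain g m where m: "m \<in> N" "m \<in> carrier R" "y = \<phi> g \<oplus> m"
        using decomposition[OF P2.Icarr[OF y]] .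
      then have "\<phi> g \<in> P2" 
        using ideal_add_cancel[OF P2.is_ideal, of "\<phi> g" m] y N_subset_prime[OF assms(3)] by auto
      then have "\<phi> g \<in> P1" using phi_preimage_dvd[OF P1.is_ideal d'P1] d'(2) by blast
      then show "y \<in> P1" using m ideal_add_mem[OF P1.is_ideal] N_subset_prime[OF assms(2)] by auto
    qed
    then show False using assms(5) by blast
  next
    assume "\<phi> c \<in> P1"
    then obtain k where "c = d * k" using d(2) by (auto simp: dvd_def)
    then have "d * 1 = d * (d' * k)" using c by (metis mult.assoc mult.commute mult_1_right)
    then have "d' dvd 1" using \<open>d \<noteq> 0\<close> by (metis dvd_triv_left mult_cancel_left)
    then have "\<phi> 1 \<in> P2" using phi_preimage_dvd[OF P2.is_ideal d'(1)] by blast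
    then show False using P2.one_imp_carrier P2.I_notcarr by (simp add: phi_one)
  qed
qed

lemma N_psubset_maximal: assumes "maximalideal P R" shows "N \<subset> P"
  using N_subset_prime[OF maximalideal_prime[OF assms]] N_not_maximal assms by blast

text \<open>The chain consisting of \<open>N\<close> and \<open>P\<close> is the longest possible one.\<close>

lemma height_maximal: assumes "maximalideal P R" shows "height R P = 1"
proof -
  let ?A = "{enat n | n. \<exists>C :: nat \<Rightarrow> 'a set.
     (\<forall>i\<le>n. primeideal (C i) R) \<and> (\<forall>i<n. C i \<subset> C (Suc i)) \<and> C n = P}"
  have "enat 1 \<in> ?A"
    using primeideal_N maximalideal_prime[OF assms] N_psubset_maximal[OF assms]
    by (auto intro!: exI[of _ "\<lambda>i. if i = 0 then N else P"] simp: le_Suc_eq)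
  moreover have "x \<le> enat 1" if xA: "x \<in> ?A" for x
  proof -
    obtain n C where n: "x = enat n" "\<forall>i\<le>n. primeideal (C i) R" "\<forall>i<n. C i \<subset> C (Suc i)"
      using xA by blast
    have "n \<le> 1"
    proof (rule ccontr)
      assume "\<not> n \<le> 1"
      then show False using n(2,3) by (intro prime_chain_length[of "C 0" "C (Suc 0)" "C (Suc (Suc 0))"]) auto
    qed
    then show ?thesis using n by simp
  qed
  ultimately have "Sup ?A = enat 1" by (intro antisym Sup_least Sup_upper)
  then show ?thesis unfolding height_def by (simp add: one_enat_def)
qed

text \<open>Suppose that \<open>P\<close> contains a regular sequence starting with \<open>x1\<close> and \<open>x2\<close>, and let \<open>J\<close> be the radical
  of \<open>(x1)\<close>. Its trace on \<open>K[x]\<close> is generated by some \<open>d\<close>, which is nonzero because \<open>x1\<close> is not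
  nilpotent. The trace of \<open>P\<close> is generated by some \<open>\<pi>\<close>; it divides \<open>d = \<pi> * d'\<close> and also the
  polynomial part \<open>g\<close> of \<open>x2\<close>. Then \<open>d'\<close> times \<open>g\<close> is a multiple of \<open>d\<close>, so \<open>d'\<close> times \<open>x2\<close> is in
  \<open>J\<close>. Since \<open>x2\<close> is a nonzerodivisor modulo \<open>(x1)\<close>, already \<open>d'\<close> is in \<open>J\<close> and hence divisible
  by \<open>d\<close>, which makes \<open>\<pi>\<close> a unit.\<close>

lemma regular_sequence_length:
  assumes P: "maximalideal P R" and reg: "regular_sequence R xs" and sub: "set xs \<subseteq> P"
  shows "length xs \<le> 1"
proof (rule ccontr)
  assume len: "\<not> length xs \<le> 1"
  interpret P: primeideal P R by (rule maximalideal_prime[OF P])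
  define x1 x2 where "x1 = xs ! 0" and "x2 = xs ! 1"
  have "xs ! 0 \<in> set xs" "xs ! 1 \<in> set xs" using len by (intro nth_mem; linarith)+
  then have x1P: "x1 \<in> P" and x2P: "x2 \<in> P" using sub by (auto simp: x1_def x2_def)
  then have x1: "x1 \<in> carrier R" and x2: "x2 \<in> carrier R" using P.Icarr by auto
  define I where "I = Idl {x1}"
  have I: "ideal I R" unfolding I_def by (rule genideal_ideal) (use x1 in simp)
  have IP: "I \<subseteq> P" unfolding I_def by (rule genideal_minimal[OF P.is_ideal]) (use x1P in simp)
  have x1I: "x1 \<in> I" unfolding I_def by (rule genideal_self'[OF x1])
  have take1: "set (take 1 xs) = {x1}" using len by (cases xs) (auto simp: x1_def)
  have regular: "\<forall>i<length xs. \<forall>y\<in>carrier R.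
      xs ! i \<otimes> y \<in> Idl (set (take i xs)) \<longrightarrow> y \<in> Idl (set (take i xs))"
    using reg[unfolded regular_sequence_def, THEN conjunct2, THEN conjunct1] .
  have reg1: "y = \<zero>" if "y \<in> carrier R" "x1 \<otimes> y = \<zero>" for y
  proof -
    have "0 < length xs" using len by linarith
    then have "xs ! 0 \<otimes> y \<in> Idl (set (take 0 xs)) \<longrightarrow> y \<in> Idl (set (take 0 xs))"
      by (rule regular[rule_format, THEN impI, OF _ that(1)])
    then show ?thesis using that by (simp add: genideal_empty x1_def)
  qed
  have reg2: "y \<in> I" if "y \<in> carrier R" "x2 \<otimes> y \<in> I" for y
  proof -
    have "1 < length xs" using len by simp
    then have "xs ! 1 \<otimes> y \<in> Idl (set (take 1 xs)) \<longrightarrow> y \<in> Idl (set (take 1 xs))"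
      by (rule regular[rule_format, THEN impI, OF _ that(1)])
    then show ?thesis using that unfolding take1 I_def x2_def by blast
  qed
  define J where "J = radical R I"
  have J: "ideal J R" unfolding J_def by (rule radical_ideal[OF I])
  have JP: "J \<subseteq> P" unfolding J_def using radical_mono[OF IP] radical_prime[OF P.primeideal] by simp
  have NJ: "N \<subseteq> J" unfolding J_def by (rule N_subset_radical[OF I])
  have NP: "N \<subseteq> P" using NJ JP by blast
  obtain f n where n: "n \<in> N" "n \<in> carrier R" "x1 = \<phi> f \<oplus> n" using decomposition[OF x1] .
  have fJ: "\<phi> f \<in> J"
    using ideal_add_cancel[OF J, of "\<phi> f" n] n NJ x1I radical_superset[OF I] by (auto simp: J_def)
  have "f \<noteq> 0"
  proof
    assume "f = 0"
    then have "x1 = n" using n by (simp add: phi_zero)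
    then obtain k :: nat where "x1 [^] k = \<zero>" using n(1) by (auto simp: N_def radical_def)
    then have "\<one> \<in> {\<zero>}"
      by (intro nonzerodivisor_pow[OF zeroideal x1, of \<one> k]) (use reg1 in auto)
    then show False using one_not_zero by simp
  qed
  obtain d where d: "\<phi> d \<in> J" "\<And>f. \<phi> f \<in> J \<Longrightarrow> d dvd f"
    using phi_preimage_principal[OF J] by blast
  have "d \<noteq> 0" using d(2)[OF fJ] \<open>f \<noteq> 0\<close> by auto
  obtain \<pi> where \<pi>: "\<phi> \<pi> \<in> P" "\<And>f. \<phi> f \<in> P \<Longrightarrow> \<pi> dvd f"
    using phi_preimage_principal[OF P.is_ideal] by blast
  obtain d' where d': "d = \<pi> * d'" using \<pi>(2) d(1) JP by (auto simp: dvd_def)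
  obtain g m where m: "m \<in> N" "m \<in> carrier R" "x2 = \<phi> g \<oplus> m" using decomposition[OF x2] .
  have "\<phi> g \<in> P" using ideal_add_cancel[OF P.is_ideal, of "\<phi> g" m] m NP x2P by auto
  then obtain h where h: "g = \<pi> * h" using \<pi>(2) by (auto simp: dvd_def)
  have "d' * g = d * h" by (simp add: h d' ac_simps)
  then have "\<phi> (d' * g) \<in> J" using phi_preimage_dvd[OF J d(1)] by simp
  moreover have "\<phi> d' \<otimes> m \<in> J" using m NJ ideal.I_l_closed[OF J] by auto
  ultimately have "x2 \<otimes> \<phi> d' \<in> J"
    using ideal_add_mem[OF J] m by (simp add: phi_mult r_distr l_distr m_comm)
  then obtain k :: nat where "(x2 \<otimes> \<phi> d') [^] k \<in> I" by (auto simp: J_def radical_def)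
  then have "x2 [^] k \<otimes> \<phi> d' [^] k \<in> I" using x2 by (simp add: nat_pow_distrib)
  then have "\<phi> d' [^] k \<in> I" by (intro nonzerodivisor_pow[OF I x2, of "\<phi> d' [^] k" k]) (use reg2 in auto)
  then have "\<phi> d' \<in> J" unfolding J_def by (rule radicalI[rotated]) simp
  then obtain c where "d' = d * c" using d(2) by (auto simp: dvd_def)
  then have "d * 1 = d * (\<pi> * c)" using d' by (metis mult.assoc mult.commute mult_1_right)
  then have "\<pi> dvd 1" using \<open>d \<noteq> 0\<close> by (metis dvd_triv_left mult_cancel_left)
  then have "\<phi> 1 \<in> P" using phi_preimage_dvd[OF P.is_ideal \<pi>(1)] by blast
  then show False using P.one_imp_carrier P.I_notcarr by (simp add: phi_one)
qed

lemma depth_maximal: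
  assumes P: "maximalideal P R"
  shows "depth R P = 1 \<longleftrightarrow> (\<exists>z\<in>P. \<forall>y\<in>carrier R. z \<otimes> y = \<zero> \<longrightarrow> y = \<zero>)"
proof -
  interpret P: maximalideal P R by fact
  let ?A = "{enat (length xs) | xs. regular_sequence R xs \<and> set xs \<subseteq> P}"
  have upper: "x \<le> enat 1" if "x \<in> ?A" for x using that regular_sequence_length[OF P] by auto
  have singleton: "regular_sequence R [z] \<longleftrightarrow> (\<forall>y\<in>carrier R. z \<otimes> y = \<zero> \<longrightarrow> y = \<zero>)" if z: "z \<in> P" for z
  proof -
    have "Idl {z} \<subseteq> P" by (rule genideal_minimal[OF P.is_ideal]) (use z in simp)
    then have "Idl {z} \<noteq> carrier R" using P.I_notcarr P.a_subset by blast
    then show ?thesis unfolding regular_sequence_def using P.Icarr[OF z] by (simp add: genideal_empty)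
  qed
  show ?thesis
  proof
    assume "depth R P = 1"
    have "\<exists>x\<in>?A. x \<noteq> 0"
    proof (rule ccontr)
      assume "\<not> ?thesis"
      then have "Sup ?A \<le> 0" by (intro Sup_least) auto
      then show False using \<open>depth R P = 1\<close> unfolding depth_def by simp
    qed
    then obtain xs where xs: "regular_sequence R xs" "set xs \<subseteq> P" "xs \<noteq> []"
      by (auto simp: zero_enat_def)
    have "length xs \<le> 1" by (rule regular_sequence_length[OF P xs(1,2)])
    then obtain z where z: "xs = [z]" using xs(3) by (cases xs) auto
    then have "z \<in> P" using xs(2) by simp
    then show "\<exists>z\<in>P. \<forall>y\<in>carrier R. z \<otimes> y = \<zero> \<longrightarrow> y = \<zero>"
      using singleton[of z] xs(1) z by blast
  next
    assume "\<exists>z\<in>P. \<forall>y\<in>carrier R. z \<otimes> y = \<zero> \<longrightarrow> y = \<zero>"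
    then obtain z where z: "z \<in> P" "\<forall>y\<in>carrier R. z \<otimes> y = \<zero> \<longrightarrow> y = \<zero>" by blast
    then have "regular_sequence R [z]" using singleton[of z] by blast
    then have "enat 1 \<in> ?A" using z(1) by (intro CollectI exI[of _ "[z]"]) simp
    then have "Sup ?A = enat 1" using upper by (intro antisym Sup_least Sup_upper)
    then show "depth R P = 1" unfolding depth_def by (simp add: one_enat_def)
  qed
qed

lemma noetherian: "noetherian_ring R"
proof (intro noetherian_ring.intro noetherian_ring_axioms.intro ring_axioms)
  fix I assume I: "ideal I R"
  have "\<exists>A\<subseteq>I. finite A \<and> (\<forall>I'. ideal I' R \<and> A \<subseteq> I' \<longrightarrow> I \<subseteq> I')"
    by (rule submodule_finitely_generated[of "\<one> # ws"])
      (use I spanning ws_closed ideal.Icarr[OF I] in \<open>auto simp del: module_span.simps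
         simp: ideal_zero_mem ideal_add_mem ideal.I_l_closed\<close>)
  then obtain A where A: "A \<subseteq> I" "finite A" "\<And>I'. ideal I' R \<Longrightarrow> A \<subseteq> I' \<Longrightarrow> I \<subseteq> I'" by blast
  have Ac: "A \<subseteq> carrier R" using A(1) ideal.Icarr[OF I] by blast
  have "I = Idl A"
    using A(3)[OF genideal_ideal[OF Ac] genideal_self[OF Ac]] genideal_minimal[OF I A(1)] by blast
  then show "\<exists>A\<subseteq>carrier R. finite A \<and> I = Idl A" using Ac A(2) by blast
qed

lemma cohen_macaulay_iff:
  "cohen_macaulay R \<longleftrightarrow>
     (\<forall>P. maximalideal P R \<longrightarrow> (\<exists>z\<in>P. \<forall>y\<in>carrier R. z \<otimes> y = \<zero> \<longrightarrow> y = \<zero>))"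
  unfolding cohen_macaulay_def using is_cring noetherian by (simp add: height_maximal depth_maximal)

text \<open>Every maximal ideal properly contains \<open>N\<close>, so it contains a nonzero polynomial.\<close>

lemma cohen_macaulayI:
  assumes "\<And>f y. f \<noteq> 0 \<Longrightarrow> y \<in> carrier R \<Longrightarrow> \<phi> f \<otimes> y = \<zero> \<Longrightarrow> y = \<zero>"
  shows "cohen_macaulay R"
  unfolding cohen_macaulay_iff
proof (intro allI impI)
  fix P assume P: "maximalideal P R"
  interpret P: maximalideal P R by fact
  obtain x where x: "x \<in> P" "x \<notin> N" using N_psubset_maximal[OF P] by blast
  obtain f n where n: "n \<in> N" "n \<in> carrier R" "x = \<phi> f \<oplus> n"
    using decomposition[OF P.Icarr[OF x(1)]] .
  have "\<phi> f \<in> P" using ideal_add_cancel[OF P.is_ideal, of "\<phi> f" n] n x(1) N_psubset_maximal[OF P] by auto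
  moreover have "f \<noteq> 0" using x n by (auto simp: phi_zero)
  ultimately show "\<exists>z\<in>P. \<forall>y\<in>carrier R. z \<otimes> y = \<zero> \<longrightarrow> y = \<zero>" using assms by blast
qed

text \<open>The annihilator of \<open>y\<close> contains \<open>x\<close> and all nilpotent generators. Modulo these, every element of the
  ring is a constant, so the annihilator is a maximal ideal, and it consists of zero divisors.\<close>

lemma not_cohen_macaulayI:
  assumes y: "y \<in> carrier R" "y \<noteq> \<zero>" and X: "\<phi> [:0, 1:] \<otimes> y = \<zero>"
    and ws: "\<And>w. w \<in> set ws \<Longrightarrow> w \<otimes> y = \<zero>"
  shows "\<not> cohen_macaulay R"
proof -
  define P where "P = {z \<in> carrier R. z \<otimes> y = \<zero>}"
  have P: "ideal P R"
    by (rule idealI_closed) (use y in \<open>auto simp: P_def l_distr m_assoc\<close>)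
  have ns: "n \<in> P" if "n \<in> module_span R \<phi> ws" for n
    using span_ws_subset[OF P] ws ws_closed that by (auto simp: P_def)
  have "maximalideal P R"
  proof (rule maximalidealI[OF P])
    have "\<one> \<notin> P" using y by (simp add: P_def)
    then show "carrier R \<noteq> P" by auto
  next
    fix J assume J: "ideal J R" "P \<subseteq> J" "J \<subseteq> carrier R"
    show "J = P \<or> J = carrier R"
    proof (cases "J \<subseteq> P")
      case False
      then obtain x where x: "x \<in> J" "x \<notin> P" by blast
      then have "x \<in> carrier R" using J(3) by blast
      then obtain f n where n: "n \<in> module_span R \<phi> ws" "n \<in> carrier R" "x = \<phi> f \<oplus> n"
        by (rule decomposition_span)
      have "\<phi> f \<in> J" using ideal_add_cancel[OF J(1), of "\<phi> f" n] n x(1) ns J(2) by auto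
      obtain a g where f: "f = pCons a g" by (cases f)
      then have f': "f = [:a:] + g * [:0, 1:]" by simp
      have gX: "\<phi> (g * [:0, 1:]) \<in> P" using X y by (simp only: phi_mult P_def) (simp add: m_assoc)
      have "a \<noteq> 0"
      proof
        assume "a = 0"
        then have "\<phi> f \<in> P" using gX f' by simp
        then show False using n ns[OF n(1)] x(2) ideal_add_mem[OF P] by simp
      qed
      have "\<phi> [:a:] \<in> J"
        using ideal_add_cancel[OF J(1), of "\<phi> [:a:]" "\<phi> (g * [:0, 1:])"] \<open>\<phi> f \<in> J\<close> gX J(2) f'
        by (metis phi_add phi_closed subsetD)
      moreover have "[:a:] dvd 1" using \<open>a \<noteq> 0\<close> by (intro dvdI[of _ _ "[:1 / a:]"]) (simp add: one_pCons)
      ultimately have "\<one> \<in> J" using phi_preimage_dvd[OF J(1)] phi_one by metis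
      then show ?thesis using ideal.one_imp_carrier[OF J(1)] by blast
    qed (use J in auto)
  qed
  moreover have "\<not> (\<exists>z\<in>P. \<forall>y\<in>carrier R. z \<otimes> y = \<zero> \<longrightarrow> y = \<zero>)" using y by (auto simp: P_def)
  ultimately show ?thesis unfolding cohen_macaulay_iff by blast
qed

end

text \<open>Being a nilpotent extension is expressed by equations between elements, so it can be transported along
  an isomorphism.\<close>

lemma nilpotent_extension_ring_iso:
  fixes R :: "('a, 'b) ring_scheme" and G :: "('c, 'd) ring_scheme"
  assumes ext: "nilpotent_extension R \<phi> ws" and h: "h \<in> ring_iso R G" and G: "cring G"
  shows "nilpotent_extension G (h \<circ> \<phi>) (map h ws)"
proof -
  interpret R: nilpotent_extension R \<phi> ws by fact
  interpret H: ring_hom_cring R G h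
    using h G R.is_cring by (intro ring_hom_cring.intro ring_hom_cring_axioms.intro) (auto simp: ring_iso_def)
  have inj: "inj_on h (carrier R)" and surj: "h ` carrier R = carrier G"
    using h by (auto simp: ring_iso_def bij_betw_def)
  have span: "h x \<in> module_span G (h \<circ> \<phi>) (map h vs)"
    if "set vs \<subseteq> carrier R" "x \<in> module_span R \<phi> vs" for x vs
    using that
  proof (induction vs arbitrary: x)
    case (Cons v vs)
    then obtain f y where x: "x = \<phi> f \<otimes>\<^bsub>R\<^esub> v \<oplus>\<^bsub>R\<^esub> y" "y \<in> module_span R \<phi> vs" by auto
    moreover have "y \<in> carrier R" using x(2) R.module_span_closed[of vs] Cons.prems(1) by auto
    ultimately have "h x = (h \<circ> \<phi>) f \<otimes>\<^bsub>G\<^esub> h v \<oplus>\<^bsub>G\<^esub> h y" using Cons.prems(1) by simp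
    moreover have "h y \<in> module_span G (h \<circ> \<phi>) (map h vs)"
      using Cons.prems(1) by (intro Cons.IH x(2)) simp
    ultimately show ?case by (simp del: o_apply) blast
  qed simp
  show ?thesis
  proof (intro nilpotent_extension.intro polynomial_algebra.intro polynomial_algebra_axioms.intro
      nilpotent_extension_axioms.intro G)
    fix f assume "(h \<circ> \<phi>) f = \<zero>\<^bsub>G\<^esub>"
    then have "h (\<phi> f) = h \<zero>\<^bsub>R\<^esub>" by simp
    then have "\<phi> f = \<zero>\<^bsub>R\<^esub>" using inj_onD[OF inj] by blast
    then show "f = 0" by (rule R.phi_inj)
  next
    fix v assume "v \<in> set (map h ws)"
    then obtain w where w: "v = h w" "w \<in> set ws" by auto
    obtain k :: nat where "w [^]\<^bsub>R\<^esub> k = \<zero>\<^bsub>R\<^esub>" using R.ws_nilpotent[OF w(2)] by blast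
    moreover have "w \<in> carrier R" using R.ws_closed w(2) by blast
    ultimately have "v [^]\<^bsub>G\<^esub> k = \<zero>\<^bsub>G\<^esub>" by (metis H.hom_pow H.hom_zero w(1))
    then show "\<exists>k::nat. v [^]\<^bsub>G\<^esub> k = \<zero>\<^bsub>G\<^esub>" by blast
  next
    have "set (\<one>\<^bsub>R\<^esub> # ws) \<subseteq> carrier R" using R.ws_closed by simp
    then have "h ` carrier R \<subseteq> module_span G (h \<circ> \<phi>) (map h (\<one>\<^bsub>R\<^esub> # ws))"
      using span R.spanning by blast
    then show "carrier G \<subseteq> module_span G (h \<circ> \<phi>) (\<one>\<^bsub>G\<^esub> # map h ws)"
      using surj by (simp del: module_span.simps)
  qed (use R.ws_closed in \<open>auto simp: R.phi_add R.phi_mult R.phi_one\<close>)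
qed

section \<open>The monomial algebra of a numerical semigroup\<close>

unbundle fps_syntax

text \<open>Zero coefficients are admitted, so that sums of monomials can run over any set of exponents.\<close>

definition fps_monomial :: "'k::field \<Rightarrow> nat \<Rightarrow> 'k fps" where
  "fps_monomial c s = fps_const c * fps_X ^ s"

lemma fps_monomial_nth [simp]: "fps_monomial c s $ n = (if n = s then c else 0)"
  by (simp add: fps_monomial_def)

lemma fps_monomial_1_0: "fps_monomial 1 0 = 1"
  by (simp add: fps_monomial_def)

context num_semigroup
begin

definition compatible :: "nat \<Rightarrow> nat \<Rightarrow> bool" where
  "compatible a b \<longleftrightarrow> a \<in> T \<and> b \<in> T \<and> ord (a + b) = ord a + ord b"

lemma compatible_commute: "compatible a b \<longleftrightarrow> compatible b a"
  by (auto simp: compatible_def add.commute)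

text \<open>As the order is superadditive, both sides say that \<open>ord (a + b + c) = ord a + ord b + ord c\<close>. This is
  what makes the truncated multiplication associative.\<close>

lemma compatible_assoc:
  "compatible a b \<and> compatible (a + b) c \<longleftrightarrow> compatible b c \<and> compatible a (b + c)"
proof -
  have "a \<in> T \<and> b \<in> T \<and> c \<in> T \<Longrightarrow>
    ord a + ord b \<le> ord (a + b) \<and> ord (a + b) + ord c \<le> ord (a + b + c) \<and>
    ord b + ord c \<le> ord (b + c) \<and> ord a + ord (b + c) \<le> ord (a + b + c)"
    using ord_superadd[of a b] ord_superadd[of "a + b" c] ord_superadd[of b c] ord_superadd[of a "b + c"]
    by (simp add: add_mem add.assoc)
  then show ?thesis unfolding compatible_def by (auto simp: add_mem add.assoc)
qed

text \<open>The multiplication of the tangent cone in the basis of monomials: the multiplication of power series,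
  restricted to the pairs of exponents whose orders add up.\<close>

definition graded_mult :: "'k::field fps \<Rightarrow> 'k fps \<Rightarrow> 'k fps" where
  "graded_mult f g = Abs_fps (\<lambda>n. \<Sum>i=0..n. if compatible i (n - i) then f $ i * g $ (n - i) else 0)"

lemma graded_mult_nth:
  "graded_mult f g $ n = (\<Sum>i=0..n. if compatible i (n - i) then f $ i * g $ (n - i) else 0)"
  by (simp add: graded_mult_def)

text \<open>Elements are stored as power series with finite support, so that addition is the one of power
  series.\<close>

definition monomial_algebra :: "'k::field fps ring" where
  "monomial_algebra = \<lparr>carrier = {f. finite {n. f $ n \<noteq> 0} \<and> (\<forall>n. f $ n \<noteq> 0 \<longrightarrow> n \<in> T)},
     monoid.mult = graded_mult, monoid.one = 1, ring.zero = 0, ring.add = (+)\<rparr>"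

abbreviation A :: "'k::field fps ring" where "A \<equiv> monomial_algebra"

lemma A_simps [simp]:
  "f \<otimes>\<^bsub>A\<^esub> g = graded_mult f g" "\<one>\<^bsub>A\<^esub> = 1" "\<zero>\<^bsub>A\<^esub> = 0" "f \<oplus>\<^bsub>A\<^esub> g = f + g"
  by (simp_all add: monomial_algebra_def)

lemma A_carrier: "f \<in> carrier A \<longleftrightarrow> finite {n. f $ n \<noteq> 0} \<and> (\<forall>n. f $ n \<noteq> 0 \<longrightarrow> n \<in> T)"
  by (simp add: monomial_algebra_def)

lemma graded_mult_commute: "graded_mult f g = graded_mult g f"
proof (rule fps_ext)
  fix n
  show "graded_mult f g $ n = graded_mult g f $ n"
    unfolding graded_mult_nth
    by (rule sum.reindex_bij_witness[of _ "\<lambda>i. n - i" "\<lambda>i. n - i"])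
      (auto simp: compatible_commute mult.commute)
qed

lemma graded_mult_assoc: "graded_mult (graded_mult f g) h = graded_mult f (graded_mult g h)"
proof (rule fps_ext)
  fix n
  define F where "F a b c = (if compatible a b \<and> compatible (a + b) c then f $ a * g $ b * h $ c else 0)" for a b c
  have F': "F a b c = (if compatible b c \<and> compatible a (b + c) then f $ a * g $ b * h $ c else 0)" for a b c
    unfolding F_def compatible_assoc ..
  have "graded_mult (graded_mult f g) h $ n = (\<Sum>j=0..n. \<Sum>i=0..j. F i (j - i) (n - j))"
    unfolding graded_mult_nth F_def
    by (intro sum.cong refl) (auto simp: sum_distrib_right intro!: sum.cong sum.neutral)
  also have "\<dots> = (\<Sum>j=0..n. \<Sum>i=0..n - j. F j i (n - j - i))"
    by (rule fps_mult_assoc_lemma)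
  also have "\<dots> = graded_mult f (graded_mult g h) $ n"
    unfolding graded_mult_nth F'
    by (intro sum.cong refl) (auto simp: sum_distrib_left mult.assoc intro!: sum.cong sum.neutral)
  finally show "graded_mult (graded_mult f g) h $ n = graded_mult f (graded_mult g h) $ n" .
qed

lemma graded_mult_distrib: "graded_mult (f + g) h = graded_mult f h + graded_mult g h"
  by (rule fps_ext) (auto simp: graded_mult_nth sum.distrib[symmetric] algebra_simps intro!: sum.cong)

lemma graded_mult_monomial_left:
  "graded_mult (fps_monomial c s) g $ n = (if s \<le> n \<and> compatible s (n - s) then c * g $ (n - s) else 0)"
proof -
  have "graded_mult (fps_monomial c s) g $ n =
      (\<Sum>i=0..n. if i = s then (if compatible s (n - s) then c * g $ (n - s) else 0) else 0)"
    unfolding graded_mult_nth by (rule sum.cong) auto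
  then show ?thesis by (simp add: sum.delta)
qed

lemma graded_mult_monomials:
  "graded_mult (fps_monomial c s) (fps_monomial d t) =
     (if compatible s t then fps_monomial (c * d) (s + t) else 0)"
  by (rule fps_ext) (auto simp: graded_mult_monomial_left)

lemma graded_mult_closed: assumes "f \<in> carrier A" "g \<in> carrier A" shows "graded_mult f g \<in> carrier A"
proof -
  have ex: "\<exists>i j. n = i + j \<and> f $ i \<noteq> 0 \<and> g $ j \<noteq> 0 \<and> compatible i j" if n: "graded_mult f g $ n \<noteq> 0" for n
  proof (rule ccontr)
    assume no: "\<not> ?thesis"
    have "graded_mult f g $ n = 0" unfolding graded_mult_nth
    proof (rule sum.neutral, rule ballI)
      fix i assume "i \<in> {0..n}"
      then have "n = i + (n - i)" by simp
      then show "(if compatible i (n - i) then f $ i * g $ (n - i) else 0) = 0" using no by auto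
    qed
    then show False using n by simp
  qed
  have "{n. graded_mult f g $ n \<noteq> 0} \<subseteq> (\<lambda>(i, j). i + j) ` ({n. f $ n \<noteq> 0} \<times> {n. g $ n \<noteq> 0})"
    using ex by fastforce
  moreover have "finite ({n. f $ n \<noteq> 0} \<times> {n. g $ n \<noteq> 0})" using assms by (simp add: A_carrier)
  ultimately have "finite {n. graded_mult f g $ n \<noteq> 0}" using finite_subset by blast
  moreover have "n \<in> T" if "graded_mult f g $ n \<noteq> 0" for n
    using ex[OF that] by (auto simp: compatible_def add_mem)
  ultimately show ?thesis by (simp add: A_carrier)
qed

lemma A_add_closed: assumes "f \<in> carrier A" "g \<in> carrier A" shows "f + g \<in> carrier A"
proof -
  have "{n. (f + g) $ n \<noteq> 0} \<subseteq> {n. f $ n \<noteq> 0} \<union> {n. g $ n \<noteq> 0}" by auto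
  moreover have "finite ({n. f $ n \<noteq> 0} \<union> {n. g $ n \<noteq> 0})" using assms by (simp add: A_carrier)
  ultimately have "finite {n. (f + g) $ n \<noteq> 0}" by (rule finite_subset)
  moreover have "n \<in> T" if "(f + g) $ n \<noteq> 0" for n
    using that assms unfolding A_carrier by (cases "f $ n = 0") auto
  ultimately show ?thesis by (simp add: A_carrier)
qed

lemma A_monomial: "s \<in> T \<Longrightarrow> fps_monomial c s \<in> carrier A"
  by (auto simp: A_carrier intro: finite_subset[of _ "{s}"])

lemma cring_A: "cring (A :: 'k::field fps ring)"
proof (rule cringI)
  show "abelian_group (A :: 'k fps ring)"
  proof (rule abelian_groupI)
    fix f :: "'k fps" assume f: "f \<in> carrier A"
    then have "- f \<in> carrier A" by (simp add: A_carrier)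
    then show "\<exists>g\<in>carrier A. g \<oplus>\<^bsub>A\<^esub> f = \<zero>\<^bsub>A\<^esub>" by (intro bexI[of _ "- f"]) auto
  qed (auto simp: A_add_closed add.assoc add.commute, simp add: A_carrier)
  have one: "graded_mult 1 f = f" if "f \<in> carrier A" for f :: "'k fps"
    by (rule fps_ext)
      (use that in \<open>auto simp: fps_monomial_1_0[symmetric] graded_mult_monomial_left compatible_def zero_mem A_carrier\<close>)
  show "comm_monoid (A :: 'k fps ring)"
  proof (rule comm_monoidI)
    show "\<one>\<^bsub>A\<^esub> \<in> carrier (A :: 'k fps ring)"
      using A_monomial[OF zero_mem, of 1] by (simp add: fps_monomial_1_0)
  qed (auto simp: graded_mult_closed graded_mult_assoc one intro: graded_mult_commute)
qed (simp add: graded_mult_distrib)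

text \<open>The substitution of \<open>t^e\<close> into a polynomial.\<close>

definition \<phi> :: "'k::field poly \<Rightarrow> 'k fps" where
  "\<phi> f = Abs_fps (\<lambda>n. if e dvd n then Polynomial.coeff f (n div e) else 0)"

lemma phi_nth: "\<phi> f $ n = (if e dvd n then Polynomial.coeff f (n div e) else 0)"
  by (simp add: \<phi>_def)

lemma phi_nth_mult: "\<phi> f $ (k * e) = Polynomial.coeff f k"
  using e_pos by (simp add: phi_nth)

lemma phi_inj: "\<phi> f = 0 \<Longrightarrow> f = 0"
proof (rule poly_eqI)
  fix n assume "\<phi> f = 0"
  then show "Polynomial.coeff f n = Polynomial.coeff 0 n" using phi_nth_mult[of f n] by simp
qed

lemma phi_closed: "\<phi> f \<in> carrier A"
proof -
  have "{n. \<phi> f $ n \<noteq> 0} \<subseteq> (\<lambda>k. k * e) ` {..Polynomial.degree f}"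
  proof
    fix n assume "n \<in> {n. \<phi> f $ n \<noteq> 0}"
    then have n: "e dvd n" "Polynomial.coeff f (n div e) \<noteq> 0" by (auto simp: phi_nth split: if_splits)
    then have "n = (n div e) * e" "n div e \<le> Polynomial.degree f" by (auto intro: le_degree)
    then show "n \<in> (\<lambda>k. k * e) ` {..Polynomial.degree f}" by blast
  qed
  then have "finite {n. \<phi> f $ n \<noteq> 0}" by (rule finite_subset) simp
  moreover have "n \<in> T" if "\<phi> f $ n \<noteq> 0" for n
  proof -
    have "e dvd n" using that by (auto simp: phi_nth split: if_splits)
    then obtain k where "n = k * e" by (auto simp: dvd_def mult.commute)
    then show ?thesis using mult_mem[OF e_in, of k] by simp
  qed
  ultimately show ?thesis by (simp add: A_carrier)
qed

lemma compatible_multiples_e: "compatible (i * e) (j * e)"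
proof -
  have "ord (i * e + j * e) = i + j" using ord_multiple_e[of "i + j"] by (simp add: algebra_simps)
  then show ?thesis by (simp add: compatible_def mult_mem e_in ord_multiple_e)
qed

lemma phi_mult: "\<phi> (f * g) = graded_mult (\<phi> f) (\<phi> g)"
proof (rule fps_ext)
  fix n
  let ?t = "\<lambda>i. if compatible i (n - i) then \<phi> f $ i * \<phi> g $ (n - i) else 0"
  show "\<phi> (f * g) $ n = graded_mult (\<phi> f) (\<phi> g) $ n"
  proof (cases "e dvd n")
    case False
    have "?t i = 0" if "i \<in> {0..n}" for i
    proof -
      have "\<not> (e dvd i \<and> e dvd n - i)" using False that by (metis atLeastAtMost_iff dvd_diffD)
      then show ?thesis by (auto simp: phi_nth)
    qed
    then show ?thesis using False by (simp add: phi_nth graded_mult_nth)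
  next
    case True
    then obtain m where m: "n = m * e" by (auto simp: dvd_def mult.commute)
    have "graded_mult (\<phi> f) (\<phi> g) $ n = sum ?t {0..n}" by (rule graded_mult_nth)
    also have "\<dots> = sum ?t ((\<lambda>i. i * e) ` {..m})"
    proof (rule sum.mono_neutral_right)
      show "(\<lambda>i. i * e) ` {..m} \<subseteq> {0..n}" by (auto simp: m)
      show "\<forall>i\<in>{0..n} - (\<lambda>i. i * e) ` {..m}. ?t i = 0"
      proof
        fix i assume i: "i \<in> {0..n} - (\<lambda>i. i * e) ` {..m}"
        have "\<not> e dvd i"
        proof
          assume "e dvd i"
          then obtain k where k: "i = k * e" by (auto simp: dvd_def mult.commute)
          then have "k \<le> m" using i m e_pos by simp
          then show False using i k by blast
        qed
        then show "?t i = 0" by (simp add: phi_nth)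
      qed
    qed simp
    also have "\<dots> = (\<Sum>i\<le>m. ?t (i * e))"
      using e_pos by (subst sum.reindex) (auto simp: inj_on_def)
    also have "\<dots> = (\<Sum>i\<le>m. Polynomial.coeff f i * Polynomial.coeff g (m - i))"
    proof (rule sum.cong[OF refl])
      fix i assume "i \<in> {..m}"
      have "n - i * e = (m - i) * e" by (simp add: m diff_mult_distrib)
      then show "?t (i * e) = Polynomial.coeff f i * Polynomial.coeff g (m - i)"
        by (simp add: compatible_multiples_e phi_nth_mult)
    qed
    also have "\<dots> = Polynomial.coeff (f * g) m" by (simp add: coeff_mult)
    finally show ?thesis by (simp add: m phi_nth_mult)
  qed
qed

lemma phi_monom: "\<phi> (Polynomial.monom c k) = fps_monomial c (k * e)"
proof (rule fps_ext)
  fix n show "\<phi> (Polynomial.monom c k) $ n = fps_monomial c (k * e) $ n"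
    using e_pos by (auto simp: phi_nth dvd_def)
qed

lemma polynomial_algebra_A: "polynomial_algebra A \<phi>"
proof (intro polynomial_algebra.intro polynomial_algebra_axioms.intro cring_A)
  show "\<phi> 1 = \<one>\<^bsub>A\<^esub>" using phi_monom[of 1 0] by (simp add: fps_monomial_1_0)
  show "\<phi> (f + g) = \<phi> f \<oplus>\<^bsub>A\<^esub> \<phi> g" for f g by (rule fps_ext) (simp add: phi_nth)
qed (simp_all add: phi_closed phi_mult)

text \<open>The exponents of the nilpotent module generators. The other elements of \<open>T\<close> that are not
  multiples of \<open>e\<close> have order above \<open>r\<close>, and their monomials are divisible by the monomial of \<open>e\<close>.\<close>

definition W :: "nat set" where "W = {w \<in> T. \<not> e dvd w \<and> ord w \<le> r}"

lemma finite_W: "finite W"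
  by (rule finite_subset[OF _ finite_ord_le[of r]]) (auto simp: W_def)

definition nilpotent_generators :: "'k::field fps list" where
  "nilpotent_generators = map (fps_monomial 1) (sorted_list_of_set W)"

lemma set_nilpotent_generators: "set nilpotent_generators = fps_monomial 1 ` W"
  by (simp add: nilpotent_generators_def finite_W)

text \<open>Subtract \<open>e\<close> as long as the order is above \<open>r\<close>: each step lowers the order by exactly one, so the
  orders of the parts add up at the end.\<close>

lemma monomial_decomposition:
  "s \<in> T \<Longrightarrow> \<exists>k w. s = k * e + w \<and> compatible (k * e) w \<and> (w = 0 \<or> w \<in> W)"
proof (induction s rule: less_induct)
  case (less s)
  consider "e dvd s" | "\<not> e dvd s" "ord s \<le> r" | "r < ord s" by linarith
  then show ?case
  proof cases
    case 1
    then obtain k where "s = k * e" by (auto simp: dvd_def mult.commute)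
    then show ?thesis using compatible_multiples_e[of k 0] by (intro exI[of _ k] exI[of _ 0]) simp
  next
    case 2
    then show ?thesis using less.prems
      by (intro exI[of _ 0] exI[of _ s]) (auto simp: W_def compatible_def zero_mem)
  next
    case 3
    then obtain s' where s': "s' \<in> T" "s = s' + e" "ord s = Suc (ord s')"
      using ord_gt_reduction[OF less.prems] by metis
    then obtain k w where kw: "s' = k * e + w" "compatible (k * e) w" "w = 0 \<or> w \<in> W"
      using less.IH[of s'] e_pos by auto
    have "s = Suc k * e + w" using s' kw by simp
    moreover have "compatible (Suc k * e) w"
      using kw s' calculation ord_multiple_e[of "Suc k"] ord_multiple_e[of k] mult_mem[OF e_in, of "Suc k"]
      by (simp add: compatible_def add_ac)
    ultimately show ?thesis using kw(3) by blast
  qed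
qed

lemma monomial_pow:
  assumes "w \<in> T"
  shows "(fps_monomial 1 w :: 'k::field fps) [^]\<^bsub>A\<^esub> (k::nat) = (if ord (k * w) = k * ord w then fps_monomial 1 (k * w) else 0)"
proof (induction k)
  case 0 show ?case by (simp add: fps_monomial_1_0)
next
  case (Suc k)
  interpret poly_A: polynomial_algebra "A :: 'k fps ring" \<phi> by (rule polynomial_algebra_A)
  have le: "k * ord w \<le> ord (k * w)" using ord_mult_superadd[OF assms zero_mem, of k] by simp
  have le': "ord w + ord (k * w) \<le> ord (w + k * w)" using ord_superadd[OF assms mult_mem[OF assms]] .
  show ?case
  proof (cases "ord (k * w) = k * ord w")
    case True
    then show ?thesis using Suc assms
      by (simp add: graded_mult_monomials compatible_def mult_mem add.commute)
  next
    case False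
    then have "ord (w + k * w) \<noteq> ord w + k * ord w" using le le' by linarith
    then show ?thesis using Suc False poly_A.l_null[of "fps_monomial 1 w"] A_monomial[OF assms, of 1] by simp
  qed
qed

lemma monomial_in_span:
  assumes "s \<in> T"
  shows "(fps_monomial c s :: 'k::field fps) \<in> module_span A \<phi> (1 # nilpotent_generators)"
proof -
  interpret poly_A: polynomial_algebra "A :: 'k fps ring" \<phi> by (rule polynomial_algebra_A)
  obtain k w where kw: "s = k * e + w" "compatible (k * e) w" "w = 0 \<or> w \<in> W"
    using monomial_decomposition[OF assms] by blast
  have sub: "set (1 # nilpotent_generators) \<subseteq> carrier (A :: 'k fps ring)"
    using poly_A.one_closed A_monomial by (auto simp: set_nilpotent_generators W_def)
  have "fps_monomial 1 w \<in> set (1 # nilpotent_generators)"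
    using kw(3) by (auto simp: set_nilpotent_generators fps_monomial_1_0)
  then have "\<phi> (Polynomial.monom c k) \<otimes>\<^bsub>A\<^esub> fps_monomial 1 w \<in> module_span A \<phi> (1 # nilpotent_generators)"
    by (intro poly_A.module_span_mult[OF sub] poly_A.module_span_mem[OF sub])
  then show ?thesis using kw(1,2) by (simp add: phi_monom graded_mult_monomials del: module_span.simps)
qed

lemma A_spanned: "carrier (A :: 'k::field fps ring) \<subseteq> module_span A \<phi> (1 # nilpotent_generators)"
proof
  interpret poly_A: polynomial_algebra "A :: 'k fps ring" \<phi> by (rule polynomial_algebra_A)
  have sub: "set (1 # nilpotent_generators) \<subseteq> carrier (A :: 'k fps ring)"
    using poly_A.one_closed A_monomial by (auto simp: set_nilpotent_generators W_def)
  fix f :: "'k fps" assume f: "f \<in> carrier A"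
  define F where "F = {n. f $ n \<noteq> 0}"
  have F: "finite F" "F \<subseteq> T" using f by (auto simp: A_carrier F_def)
  have "(\<Sum>n\<in>B. fps_monomial (f $ n) n) \<in> module_span A \<phi> (1 # nilpotent_generators)"
    if "finite B" "B \<subseteq> T" for B using that
  proof (induction B rule: finite_induct)
    case empty
    then show ?case using poly_A.module_span_zero[OF sub] by simp
  next
    case (insert s B)
    then show ?case
      using poly_A.module_span_add[OF sub monomial_in_span[of s "f $ s"], of "\<Sum>n\<in>B. fps_monomial (f $ n) n"]
      by (simp del: module_span.simps)
  qed
  then have "(\<Sum>n\<in>F. fps_monomial (f $ n) n) \<in> module_span A \<phi> (1 # nilpotent_generators)"
    using F by blast
  moreover have "(\<Sum>n\<in>F. fps_monomial (f $ n) n) = f"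
  proof (rule fps_ext)
    fix m
    have "(\<Sum>n\<in>F. fps_monomial (f $ n) n) $ m = (\<Sum>n\<in>F. if n = m then f $ m else 0)"
      unfolding fps_sum_nth by (rule sum.cong) auto
    then show "(\<Sum>n\<in>F. fps_monomial (f $ n) n) $ m = f $ m" using F(1) by (simp add: sum.delta F_def)
  qed
  ultimately show "f \<in> module_span A \<phi> (1 # nilpotent_generators)" by (simp only:)
qed

text \<open>The monomial of \<open>w\<close> vanishes when raised to the power \<open>e\<close>: the order of \<open>e * w\<close> is \<open>w\<close>, which
  differs from \<open>e * ord w\<close> unless \<open>e\<close> divides \<open>w\<close>.\<close>

lemma nilpotent_extension_A: "nilpotent_extension (A :: 'k::field fps ring) \<phi> nilpotent_generators"
proof (intro nilpotent_extension.intro nilpotent_extension_axioms.intro polynomial_algebra_A)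
  show "set nilpotent_generators \<subseteq> carrier A"
    using A_monomial by (auto simp: set_nilpotent_generators W_def)
  show "carrier A \<subseteq> module_span A \<phi> (\<one>\<^bsub>A\<^esub> # nilpotent_generators)"
    using A_spanned by (simp only: A_simps)
next
  fix v :: "'k fps" assume "v \<in> set nilpotent_generators"
  then obtain w where w: "v = fps_monomial 1 w" "w \<in> T" "\<not> e dvd w"
    by (auto simp: set_nilpotent_generators W_def)
  have "ord (e * w) = w" using ord_multiple_e[of w] by (simp add: mult.commute)
  then have "ord (e * w) \<noteq> e * ord w" using w(3) by (metis dvd_triv_left)
  then have "v [^]\<^bsub>A\<^esub> e = \<zero>\<^bsub>A\<^esub>" using monomial_pow[OF w(2), of e] w(1) by simp
  then show "\<exists>k::nat. v [^]\<^bsub>A\<^esub> k = \<zero>\<^bsub>A\<^esub>" by blast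
qed (use phi_inj in simp)

text \<open>Under the criterion the orders of \<open>k * e\<close> and of any element of \<open>T\<close> add up, so multiplication by
  a polynomial in \<open>t^e\<close> is the multiplication of power series, which form an integral domain.\<close>

lemma phi_nonzerodivisor_of_regular:
  assumes reg: ord_regular and f: "f \<noteq> 0" and y: "y \<in> carrier A" and zero: "graded_mult (\<phi> f) y = 0"
  shows "y = 0"
proof -
  have ord_shift: "ord (s + k * e) = ord s + k" if "s \<in> T" for s k
  proof (induction k)
    case (Suc k)
    have "s + k * e \<in> T" using that mult_mem[OF e_in] add_mem by blast
    then have "ord (s + k * e + e) = Suc (ord (s + k * e))" using reg by (simp add: ord_regular_def)
    then show ?case using Suc by (simp add: algebra_simps)
  qed simp
  have "graded_mult (\<phi> f) y $ n = (\<phi> f * y) $ n" for n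
    unfolding graded_mult_nth fps_mult_nth
  proof (rule sum.cong[OF refl])
    fix i
    have "compatible i (n - i)" if "\<phi> f $ i \<noteq> 0" "y $ (n - i) \<noteq> 0"
    proof -
      have "e dvd i" using that(1) by (auto simp: phi_nth split: if_splits)
      then obtain k where "i = k * e" by (auto simp: dvd_def mult.commute)
      moreover have "n - i \<in> T" using that(2) y by (simp add: A_carrier)
      ultimately show ?thesis using ord_shift[of "n - i" k]
        by (simp add: compatible_def mult_mem e_in ord_multiple_e add.commute)
    qed
    then show "(if compatible i (n - i) then \<phi> f $ i * y $ (n - i) else 0) = \<phi> f $ i * y $ (n - i)"
      by auto
  qed
  then have "\<phi> f * y = graded_mult (\<phi> f) y" by (intro fps_ext) simp
  then have "\<phi> f * y = 0" using zero by simp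
  moreover have "\<phi> f \<noteq> 0" using phi_inj f by blast
  ultimately show ?thesis by simp
qed

text \<open>The criterion can fail only at finitely many \<open>s\<close>, those of order below \<open>r\<close>. Take \<open>y\<close> to be the
  monomial of the largest such \<open>s\<close>. If its product with the monomial of \<open>w > 0\<close> were nonzero, the
  criterion would also fail at \<open>w + s\<close>.\<close>

lemma socle_element_of_irregular:
  assumes "\<not> ord_regular"
  shows "\<exists>y\<in>carrier (A :: 'k::field fps ring). y \<noteq> 0 \<and> graded_mult (\<phi> [:0, 1:]) y = 0 \<and>
    (\<forall>v\<in>set nilpotent_generators. graded_mult v y = 0)"
proof -
  define B where "B = {s \<in> T. ord (s + e) \<noteq> Suc (ord s)}"
  have "B \<subseteq> {s \<in> T. ord s \<le> r}" using ord_add_e nat_le_linear by (fastforce simp: B_def)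
  then have fin: "finite B" using finite_ord_le finite_subset by blast
  have ne: "B \<noteq> {}" using assms by (auto simp: B_def ord_regular_def)
  define s where "s = Max B"
  have "s \<in> B" unfolding s_def using fin ne by (rule Max_in)
  then have s: "s \<in> T" "Suc (ord s) < ord (s + e)"
    using ord_superadd[of s e] e_in ord_pos[OF e_mem] by (auto simp: B_def)
  have kill: "\<not> compatible w s" if "w \<in> M" for w
  proof
    assume "compatible w s"
    then have ws: "ord (w + s) = ord w + ord s" by (simp add: compatible_def)
    have "ord w + ord (s + e) \<le> ord (w + (s + e))"
      using that s(1) e_in by (intro ord_superadd) (auto intro: add_mem)
    then have "Suc (ord (w + s)) < ord (w + s + e)" using s(2) ws by (simp add: add.assoc)
    then have "w + s \<in> B" using that s(1) by (auto simp: B_def intro: add_mem)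
    then have "w + s \<le> Max B" by (rule Max_ge[OF fin])
    then show False using that by (simp add: s_def)
  qed
  have X: "[:0, 1:] = Polynomial.monom (1::'k) 1" by (simp add: monom_altdef)
  show ?thesis
  proof (intro bexI[of _ "fps_monomial 1 s"] conjI ballI)
    show "fps_monomial 1 s \<in> carrier A" using A_monomial[OF s(1)] .
    show "fps_monomial 1 s \<noteq> (0 :: 'k fps)" by (metis fps_monomial_nth fps_zero_nth zero_neq_one)
    show "graded_mult (\<phi> [:0, 1:]) (fps_monomial 1 s) = (0 :: 'k fps)"
      using kill[OF e_mem] by (simp add: X phi_monom graded_mult_monomials)
  next
    fix v :: "'k fps" assume "v \<in> set nilpotent_generators"
    then obtain w where "v = fps_monomial 1 w" "w \<in> T" "\<not> e dvd w"
      by (auto simp: set_nilpotent_generators W_def)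
    moreover from this have "w \<in> M" by (cases "w = 0") auto
    ultimately show "graded_mult v (fps_monomial 1 s) = 0"
      using kill[of w] by (simp add: graded_mult_monomials)
  qed
qed

end

section \<open>The tangent cone as a monomial algebra\<close>

context num_semigroup
begin

abbreviation R :: "'k::field fps ring" where "R \<equiv> semigroup_ring T"

lemma R_simps [simp]:
  "f \<otimes>\<^bsub>R\<^esub> g = f * g" "\<one>\<^bsub>R\<^esub> = 1" "\<zero>\<^bsub>R\<^esub> = 0" "f \<oplus>\<^bsub>R\<^esub> g = f + g"
  by (simp_all add: semigroup_ring_def)

text \<open>These sets turn out to be the powers of the maximal ideal.\<close>

definition F :: "nat \<Rightarrow> 'k::field fps set" where
  "F n = {f. \<forall>m. f $ m \<noteq> 0 \<longrightarrow> m \<in> multiple T n}"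

lemma F_iff: "f \<in> F n \<longleftrightarrow> (\<forall>m. f $ m \<noteq> 0 \<longrightarrow> m \<in> multiple T n)"
  by (simp add: F_def)

lemma F_nth_eq_0: "f \<in> F n \<Longrightarrow> m \<notin> multiple T n \<Longrightarrow> f $ m = 0"
  by (auto simp: F_iff)

lemma carrier_R: "carrier R = F 0"
  by (simp add: semigroup_ring_def F_def)

lemma F_antimono: "m \<le> n \<Longrightarrow> F n \<subseteq> F m"
  using multiple_antimono[of m n] by (auto simp: F_def)

lemma F_zero: "0 \<in> F n"
  by (simp add: F_iff)

lemma F_add: "f \<in> F n \<Longrightarrow> g \<in> F n \<Longrightarrow> f + g \<in> F n"
  unfolding F_iff by (metis add.right_neutral fps_add_nth)

lemma F_uminus: "f \<in> F n \<Longrightarrow> - f \<in> F n"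
  by (simp add: F_iff)

lemma F_diff: "f \<in> F n \<Longrightarrow> g \<in> F n \<Longrightarrow> f - g \<in> F n"
  using F_add[OF _ F_uminus, of f n g] by simp

lemma F_sum: "(\<And>i. i \<in> B \<Longrightarrow> f i \<in> F n) \<Longrightarrow> sum f B \<in> F n"
  by (induction B rule: infinite_finite_induct) (auto simp: F_zero F_add)

lemma F_mult: assumes "f \<in> F i" "g \<in> F j" shows "f * g \<in> F (i + j)"
  unfolding F_iff
proof (intro allI impI)
  fix m assume "(f * g) $ m \<noteq> 0"
  then obtain k where "k \<in> {0..m}" "f $ k * g $ (m - k) \<noteq> 0"
    unfolding fps_mult_nth by (rule sum.not_neutral_contains_not_neutral)
  then have k: "k \<le> m" "f $ k \<noteq> 0" "g $ (m - k) \<noteq> 0" by auto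
  then have "k + (m - k) \<in> multiple T (i + j)" using assms by (intro multiple_add) (auto simp: F_iff)
  then show "m \<in> multiple T (i + j)" using k(1) by simp
qed

lemma F_monomial: "s \<in> multiple T n \<Longrightarrow> fps_monomial c s \<in> F n"
  by (simp add: F_iff)

lemma cring_R: "cring (R :: 'k::field fps ring)"
proof (rule cringI)
  show "abelian_group (R :: 'k fps ring)"
  proof (rule abelian_groupI)
    fix f :: "'k fps" assume f: "f \<in> carrier R"
    then have "- f \<in> carrier R" by (simp add: carrier_R F_uminus)
    then show "\<exists>g\<in>carrier R. g \<oplus>\<^bsub>R\<^esub> f = \<zero>\<^bsub>R\<^esub>" by (intro bexI[of _ "- f"]) auto
  qed (auto simp: carrier_R F_add F_zero)
  show "comm_monoid (R :: 'k fps ring)"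
  proof (rule comm_monoidI)
    show "\<one>\<^bsub>R\<^esub> \<in> carrier (R :: 'k fps ring)"
      using F_monomial[of 0 0 1] zero_mem by (simp add: carrier_R fps_monomial_1_0)
  qed (use F_mult[of _ 0 _ 0] in \<open>auto simp: carrier_R mult.assoc mult.commute\<close>)
qed (simp add: distrib_right)

lemma ideal_F: "ideal (F n) (R :: 'k::field fps ring)"
proof -
  interpret R: cring "R :: 'k fps ring" by (rule cring_R)
  show ?thesis
    by (rule R.idealI_closed)
      (use F_mult[of _ 0 _ n] F_antimono[of 0 n] in \<open>auto simp: carrier_R F_zero F_add\<close>)
qed

text \<open>The set \<open>(n+1)M\<close> differs from \<open>e + nM\<close> by finitely many exponents only. So a series supported on it
  is a multiple of \<open>t^e\<close> plus a polynomial, which makes it a finite sum of products although its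
  support may be infinite.\<close>

lemma F_Suc_decomposition:
  assumes "f \<in> F (Suc n)"
  shows "\<exists>g B. g \<in> F n \<and> finite B \<and> B \<subseteq> multiple T (Suc n) \<and>
    f = g * fps_monomial 1 e + (\<Sum>s\<in>B. fps_monomial (f $ s) s)"
proof (intro exI conjI)
  define B where "B = multiple T (Suc n) - (\<lambda>x. e + x) ` multiple T n"
  define g where "g = Abs_fps (\<lambda>m. if m \<in> multiple T n then f $ (m + e) else 0)"
  show "g \<in> F n" by (simp add: F_iff g_def)
  have "B \<subseteq> - ((\<lambda>x. e + x) ` multiple T n)" by (auto simp: B_def)
  moreover have "finite (- ((\<lambda>x. e + x) ` multiple T n))"
    unfolding compl_shift using cofinite_multiple by simp
  ultimately show B: "finite B" by (rule finite_subset)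
  show "B \<subseteq> multiple T (Suc n)" by (auto simp: B_def)
  show "f = g * fps_monomial 1 e + (\<Sum>s\<in>B. fps_monomial (f $ s) s)"
  proof (rule fps_ext)
    fix m
    have "(\<Sum>s\<in>B. fps_monomial (f $ s) s) $ m = (\<Sum>s\<in>B. if s = m then f $ m else 0)"
      unfolding fps_sum_nth by (rule sum.cong) auto
    then have sum: "(\<Sum>s\<in>B. fps_monomial (f $ s) s) $ m = (if m \<in> B then f $ m else 0)"
      using B by (simp add: sum.delta)
    have shift: "(g * fps_monomial 1 e) $ m = (if m < e then 0 else g $ (m - e))"
      by (simp add: fps_monomial_def fps_X_power_mult_right_nth)
    show "f $ m = (g * fps_monomial 1 e + (\<Sum>s\<in>B. fps_monomial (f $ s) s)) $ m"
    proof (cases "m \<in> (\<lambda>x. e + x) ` multiple T n")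
      case True
      then obtain x where "m = e + x" "x \<in> multiple T n" by blast
      then show ?thesis using sum shift by (auto simp: B_def g_def add.commute)
    next
      case False
      then have "m - e \<notin> multiple T n" if "\<not> m < e" using that by (auto simp: image_iff)
      then have "(g * fps_monomial 1 e) $ m = 0" using shift by (simp add: g_def)
      moreover have "f $ m = (if m \<in> B then f $ m else 0)"
        using False F_nth_eq_0[OF assms, of m] by (auto simp: B_def)
      ultimately show ?thesis using sum by simp
    qed
  qed
qed

text \<open>This is used to see that \<open>F (Suc n)\<close> lies in the product of \<open>F n\<close> with the maximal ideal, and in the
  case \<open>n = 0\<close> that the ideal generated by all monomials contains infinite series as well.\<close>

lemma F_Suc_subset:
  fixes J :: "'k::field fps set"
  assumes zero: "0 \<in> J" and add: "\<And>x y. x \<in> J \<Longrightarrow> y \<in> J \<Longrightarrow> x + y \<in> J"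
    and prod: "\<And>f c s. f \<in> F n \<Longrightarrow> s \<in> M \<Longrightarrow> f * fps_monomial 1 s \<in> J"
  shows "F (Suc n) \<subseteq> J"
proof
  fix f :: "'k fps" assume "f \<in> F (Suc n)"
  then obtain g B where gB: "g \<in> F n" "finite B" "B \<subseteq> multiple T (Suc n)"
    and f: "f = g * fps_monomial 1 e + (\<Sum>s\<in>B. fps_monomial (f $ s) s)"
    using F_Suc_decomposition by blast
  have monomial: "fps_monomial c s \<in> J" if s: "s \<in> multiple T (Suc n)" for c :: 'k and s
  proof -
    obtain a b where ab: "s = a + b" "a \<in> T" "a \<noteq> 0" "b \<in> multiple T n"
      using s by (rule multiple_SucE)
    have "fps_monomial c b * fps_monomial 1 a \<in> J" using ab by (intro prod F_monomial) auto
    then show ?thesis by (simp add: fps_monomial_def ab(1) power_add mult_ac)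
  qed
  have "(\<Sum>s\<in>B. fps_monomial (f $ s) s) \<in> J" using gB(2,3)
    by (induction B rule: finite_induct) (auto intro: zero add monomial)
  then show "f \<in> J" using f add prod[OF gB(1) e_mem] by metis
qed

lemma semigroup_max_ideal_eq: "semigroup_max_ideal T = (F 1 :: 'k::field fps set)"
proof -
  interpret R: cring "R :: 'k fps ring" by (rule cring_R)
  let ?G = "{fps_X ^ s | s. s \<in> M} :: 'k fps set"
  have mono: "fps_X ^ s = (fps_monomial 1 s :: 'k fps)" for s by (simp add: fps_monomial_def)
  have G1: "?G \<subseteq> F 1"
  proof
    fix x assume "x \<in> ?G"
    then obtain s where "x = fps_monomial 1 s" "s \<in> M" using mono by auto
    moreover have "s \<in> multiple T 1" using multiple_iff_ord[of s 1] ord_pos[of s] calculation by simp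
    ultimately show "x \<in> F 1" using F_monomial by blast
  qed
  then have Gc: "?G \<subseteq> carrier R" using F_antimono[of 0 1] by (auto simp: carrier_R)
  have I: "ideal (Idl\<^bsub>R\<^esub> ?G) R" by (rule R.genideal_ideal[OF Gc])
  have "F (Suc 0) \<subseteq> Idl\<^bsub>R\<^esub> ?G"
  proof (rule F_Suc_subset)
    show "0 \<in> Idl\<^bsub>R\<^esub> ?G" using R.ideal_zero_mem[OF I] by simp
    show "x + y \<in> Idl\<^bsub>R\<^esub> ?G" if "x \<in> Idl\<^bsub>R\<^esub> ?G" "y \<in> Idl\<^bsub>R\<^esub> ?G" for x y
      using R.ideal_add_mem[OF I that] by simp
    show "f * fps_monomial 1 s \<in> Idl\<^bsub>R\<^esub> ?G" if "f \<in> F 0" "s \<in> M" for f :: "'k fps" and s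
    proof -
      have "fps_X ^ s \<in> ?G" using that(2) by blast
      then have "fps_monomial 1 s \<in> Idl\<^bsub>R\<^esub> ?G" using R.genideal_self[OF Gc] mono[of s] by auto
      then show ?thesis using ideal.I_l_closed[OF I, of _ f] that(1) by (simp add: carrier_R)
    qed
  qed
  moreover have "Idl\<^bsub>R\<^esub> ?G \<subseteq> F 1" by (rule R.genideal_minimal[OF ideal_F G1])
  ultimately show ?thesis unfolding semigroup_max_ideal_def by simp
qed

lemma ideal_power_eq: "ideal_power R (F 1) n = (F n :: 'k::field fps set)"
proof (induction n)
  case 0
  show ?case by (simp add: nat_pow_def ideals_set_def carrier_R)
next
  case (Suc n)
  have "ideal_power R (F 1) (Suc n) = ideal_prod R (ideal_power R (F 1) n) (F 1 :: 'k fps set)"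
    by (simp add: nat_pow_def ideals_set_def)
  also have "\<dots> = ideal_prod R (F n) (F 1)" by (simp only: Suc)
  also have "\<dots> = F (Suc n)"
  proof
    show "ideal_prod R (F n) (F 1) \<subseteq> (F (Suc n) :: 'k fps set)"
    proof
      fix x :: "'k fps" assume "x \<in> ideal_prod R (F n) (F 1)"
      then show "x \<in> F (Suc n)"
      proof (induction x rule: ideal_prod.induct)
        case (prod i j) then show ?case using F_mult[of i n j 1] by simp
      next
        case (sum x y) then show ?case using F_add by simp
      qed
    qed
    show "(F (Suc n) :: 'k fps set) \<subseteq> ideal_prod R (F n) (F 1)"
    proof (rule F_Suc_subset)
      show "0 \<in> ideal_prod R (F n) (F 1)" using ideal_prod.prod[OF F_zero F_zero, of R n 1] by simp
      show "x + y \<in> ideal_prod R (F n) (F 1)"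
        if "x \<in> ideal_prod R (F n) (F 1)" "y \<in> ideal_prod R (F n) (F 1)" for x y
        using ideal_prod.sum[OF that] by simp
      show "f * fps_monomial 1 s \<in> ideal_prod R (F n) (F 1)" if "f \<in> F n" "s \<in> M" for f :: "'k fps" and s
      proof -
        have "fps_monomial 1 s \<in> F 1"
          using that(2) multiple_iff_ord[of s 1] ord_pos[of s] by (intro F_monomial) simp
        then show ?thesis using ideal_prod.prod[OF that(1), of _ "F 1" R] by simp
      qed
    qed
  qed
  finally show ?case .
qed

definition homogeneous_part :: "nat \<Rightarrow> 'k::field fps \<Rightarrow> 'k fps" where
  "homogeneous_part n f = Abs_fps (\<lambda>m. if m \<in> T \<and> ord m = n then f $ m else 0)"

lemma homogeneous_part_nth: "homogeneous_part n f $ m = (if m \<in> T \<and> ord m = n then f $ m else 0)"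
  by (simp add: homogeneous_part_def)

lemma homogeneous_part_F: "homogeneous_part n f \<in> F n"
  by (auto simp: F_iff homogeneous_part_nth multiple_iff_ord)

text \<open>The value at \<open>n\<close> is the class of the part of \<open>f\<close> supported on the exponents of order \<open>n\<close>; these
  exponents are \<open>nM\<close> without \<open>(n+1)M\<close>, so they index a basis of the graded piece of degree \<open>n\<close>.\<close>

definition graded_iso :: "'k::field fps \<Rightarrow> nat \<Rightarrow> 'k fps set" where
  "graded_iso f = (\<lambda>n. F (Suc n) +>\<^bsub>R\<^esub> homogeneous_part n f)"

lemma coset_iff: "y \<in> F n +>\<^bsub>R\<^esub> x \<longleftrightarrow> y - x \<in> F n"
  unfolding a_r_coset_def' by (auto intro: bexI[of _ "y - x"])

lemma coset_eqI: assumes "x - y \<in> F n" shows "F n +>\<^bsub>R\<^esub> x = F n +>\<^bsub>R\<^esub> y"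
proof (rule Set.set_eqI)
  fix z
  have "z - y = (z - x) + (x - y)" "z - x = (z - y) - (x - y)" by simp_all
  then show "z \<in> F n +>\<^bsub>R\<^esub> x \<longleftrightarrow> z \<in> F n +>\<^bsub>R\<^esub> y"
    unfolding coset_iff using assms F_add F_diff by metis
qed

lemma coset_eqD: assumes "F n +>\<^bsub>R\<^esub> x = F n +>\<^bsub>R\<^esub> y" shows "x - y \<in> F n"
proof -
  have "x \<in> F n +>\<^bsub>R\<^esub> x" by (simp add: coset_iff F_zero)
  then show ?thesis using assms by (simp add: coset_iff)
qed

lemma coset_0: "F n +>\<^bsub>R\<^esub> 0 = F n"
  by (auto simp: coset_iff)

text \<open>The general construction of the associated graded ring, with the powers of the maximal ideal made
  explicit.\<close>

lemma tangent_cone_eq: "tangent_cone T =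
     \<lparr>carrier = {g. (\<forall>n. \<exists>x\<in>F n. g n = F (Suc n) +>\<^bsub>R\<^esub> x) \<and> finite {n. g n \<noteq> F (Suc n)}},
      monoid.mult = (\<lambda>g h n. finsum (R Quot F (Suc n)) (\<lambda>i. rcoset_mult R (F (Suc n)) (g i) (h (n - i))) {..n}),
      monoid.one = (\<lambda>n. if n = 0 then F (Suc 0) +>\<^bsub>R\<^esub> 1 else F (Suc n)),
      ring.zero = (\<lambda>n. F (Suc n)),
      ring.add = (\<lambda>g h n. g n <+>\<^bsub>R\<^esub> h n)\<rparr>"
  unfolding tangent_cone_def associated_graded_def semigroup_max_ideal_eq ideal_power_eq R_simps ..

text \<open>The factors are cosets of two different powers of the maximal ideal. Changing a factor by an element of
  its power changes the product by an element of \<open>F (Suc (i + j))\<close>, because the other factor has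
  degree \<open>j\<close> or \<open>i\<close>.\<close>

lemma rcoset_mult_cosets:
  assumes x: "x \<in> F i" and y: "y \<in> F j"
  shows "rcoset_mult R (F (Suc (i + j))) (F (Suc i) +>\<^bsub>R\<^esub> x) (F (Suc j) +>\<^bsub>R\<^esub> y) = F (Suc (i + j)) +>\<^bsub>R\<^esub> (x * y)"
proof -
  have eq: "F (Suc (i + j)) +>\<^bsub>R\<^esub> (a * b) = F (Suc (i + j)) +>\<^bsub>R\<^esub> (x * y)"
    if a: "a \<in> F (Suc i) +>\<^bsub>R\<^esub> x" and b: "b \<in> F (Suc j) +>\<^bsub>R\<^esub> y" for a b
  proof (rule coset_eqI)
    have ax: "a - x \<in> F (Suc i)" and bY: "b - y \<in> F (Suc j)" using a b by (simp_all add: coset_iff)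
    have "b = (b - y) + y" by simp
    then have "b \<in> F j" using F_add[OF _ y, of "b - y"] bY F_antimono[of j "Suc j"] by auto
    then have "(a - x) * b \<in> F (Suc (i + j))" using F_mult[OF ax] by fastforce
    moreover have "x * (b - y) \<in> F (Suc (i + j))" using F_mult[OF x bY] by simp
    ultimately have "(a - x) * b + x * (b - y) \<in> F (Suc (i + j))" by (rule F_add)
    then show "a * b - x * y \<in> F (Suc (i + j))" by (simp add: algebra_simps)
  qed
  have "x \<in> F (Suc i) +>\<^bsub>R\<^esub> x" "y \<in> F (Suc j) +>\<^bsub>R\<^esub> y" by (simp_all add: coset_iff F_zero)
  then show ?thesis unfolding rcoset_mult_def R_simps using eq by blast
qed

lemma finsum_cosets:
  fixes x :: "nat \<Rightarrow> 'k::field fps"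
  assumes "\<And>i. x i \<in> F 0"
  shows "finsum (R Quot F k) (\<lambda>i. F k +>\<^bsub>R\<^esub> x i) {..n} = F k +>\<^bsub>R\<^esub> (\<Sum>i\<le>n. x i)"
proof -
  interpret I: ideal "F k" "R :: 'k fps ring" by (rule ideal_F)
  interpret H: ring_hom_ring "R :: 'k fps ring" "R Quot F k" "(+>\<^bsub>R\<^esub>) (F k)" by (rule I.rcos_ring_hom_ring)
  have "finsum R x {..n} = (\<Sum>i\<le>n. x i)"
    by (induction n) (use assms in \<open>simp_all add: carrier_R Pi_def add.commute\<close>)
  moreover have "F k +>\<^bsub>R\<^esub> (finsum R x {..n}) = finsum (R Quot F k) ((+>\<^bsub>R\<^esub>) (F k) \<circ> x) {..n}"
    using assms by (intro H.hom_finsum) (simp add: carrier_R Pi_def)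
  ultimately show ?thesis by (simp add: o_def)
qed

text \<open>Only the exponents \<open>m\<close> of order \<open>n\<close> matter modulo \<open>F (Suc n)\<close>. For these, a pair \<open>j\<close>, \<open>m - j\<close>
  contributes to the left sum when the two orders add up to \<open>n = ord m\<close>, which is the condition for
  a nonzero product of the two monomials.\<close>

lemma homogeneous_part_graded_mult:
  "(\<Sum>i\<le>n. homogeneous_part i f * homogeneous_part (n - i) g) - homogeneous_part n (graded_mult f g) \<in> F (Suc n)"
  unfolding F_iff
proof (intro allI impI, rule ccontr)
  fix m
  let ?D = "(\<Sum>i\<le>n. homogeneous_part i f * homogeneous_part (n - i) g) - homogeneous_part n (graded_mult f g)"
  assume nz: "?D $ m \<noteq> 0" and m: "m \<notin> multiple T (Suc n)"
  have "homogeneous_part i f * homogeneous_part (n - i) g \<in> F n" if "i \<le> n" for i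
    using F_mult[OF homogeneous_part_F homogeneous_part_F, of i f "n - i" g] that by simp
  then have "?D \<in> F n" by (intro F_diff F_sum homogeneous_part_F) auto
  then have "m \<in> multiple T n" using nz by (auto simp: F_iff)
  then have mT: "m \<in> T" using multiple_subset by blast
  then have om: "ord m = n" using \<open>m \<in> multiple T n\<close> m multiple_iff_ord[OF mT] by force
  have "(\<Sum>i\<le>n. homogeneous_part i f * homogeneous_part (n - i) g) $ m
      = (\<Sum>j=0..m. \<Sum>i\<le>n. homogeneous_part i f $ j * homogeneous_part (n - i) g $ (m - j))"
    unfolding fps_sum_nth fps_mult_nth by (rule sum.swap)
  also have "\<dots> = (\<Sum>j=0..m. if compatible j (m - j) then f $ j * g $ (m - j) else 0)"
  proof (rule sum.cong[OF refl])
    fix j assume "j \<in> {0..m}"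
    then have jm: "j + (m - j) = m" by simp
    have "(\<Sum>i\<le>n. homogeneous_part i f $ j * homogeneous_part (n - i) g $ (m - j))
        = (\<Sum>i\<le>n. if i = ord j then (if compatible j (m - j) then f $ j * g $ (m - j) else 0) else 0)"
    proof (rule sum.cong[OF refl])
      fix i assume "i \<in> {..n}"
      then show "homogeneous_part i f $ j * homogeneous_part (n - i) g $ (m - j)
          = (if i = ord j then (if compatible j (m - j) then f $ j * g $ (m - j) else 0) else 0)"
        using jm om by (auto simp: homogeneous_part_nth compatible_def)
    qed
    also have "\<dots> = (if compatible j (m - j) then f $ j * g $ (m - j) else 0)"
      using jm om by (auto simp: sum.delta compatible_def)
    finally show "(\<Sum>i\<le>n. homogeneous_part i f $ j * homogeneous_part (n - i) g $ (m - j))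
      = (if compatible j (m - j) then f $ j * g $ (m - j) else 0)" .
  qed
  also have "\<dots> = homogeneous_part n (graded_mult f g) $ m"
    using mT om by (simp add: homogeneous_part_nth graded_mult_nth)
  finally show False using nz by simp
qed

lemma graded_iso_zero: "graded_iso (0 :: 'k::field fps) = \<zero>\<^bsub>tangent_cone T\<^esub>"
proof -
  have "homogeneous_part n (0 :: 'k fps) = 0" for n by (rule fps_ext) (simp add: homogeneous_part_nth)
  then show ?thesis by (simp add: graded_iso_def tangent_cone_eq coset_0)
qed

lemma graded_iso_closed: 
  fixes f :: "'k::field fps"
  assumes "f \<in> carrier A" shows "graded_iso f \<in> carrier (tangent_cone T)"
proof -
  have "{n. graded_iso f n \<noteq> F (Suc n)} \<subseteq> ord ` {m. f $ m \<noteq> 0}"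
  proof
    fix n assume n: "n \<in> {n. graded_iso f n \<noteq> F (Suc n)}"
    have "homogeneous_part n f \<noteq> 0" using n by (auto simp: graded_iso_def coset_0)
    then obtain m where "homogeneous_part n f $ m \<noteq> 0" by (auto simp: fps_eq_iff)
    then show "n \<in> ord ` {m. f $ m \<noteq> 0}" by (auto simp: homogeneous_part_nth split: if_splits)
  qed
  moreover have "finite (ord ` {m. f $ m \<noteq> 0})" using assms by (simp add: A_carrier)
  ultimately have "finite {n. graded_iso f n \<noteq> F (Suc n)}" by (rule finite_subset)
  then show ?thesis using homogeneous_part_F by (auto simp: tangent_cone_eq graded_iso_def)
qed

lemma graded_iso_mult: "graded_iso (graded_mult f g) = graded_iso f \<otimes>\<^bsub>tangent_cone T\<^esub> graded_iso g"
proof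
  fix n
  have coset: "rcoset_mult R (F (Suc n)) (graded_iso f i) (graded_iso g (n - i))
      = F (Suc n) +>\<^bsub>R\<^esub> (homogeneous_part i f * homogeneous_part (n - i) g)" if "i \<le> n" for i
    using rcoset_mult_cosets[OF homogeneous_part_F[of i f] homogeneous_part_F[of "n - i" g]] that
    by (simp add: graded_iso_def)
  have hom: "homogeneous_part i f * homogeneous_part (n - i) g \<in> F 0" for i
    using F_mult[OF homogeneous_part_F homogeneous_part_F] F_antimono[of 0] by blast
  interpret Q: ring "R Quot (F (Suc n) :: 'a fps set)" by (rule ideal.quotient_is_ring[OF ideal_F])
  have "(graded_iso f \<otimes>\<^bsub>tangent_cone T\<^esub> graded_iso g) n
      = finsum (R Quot F (Suc n)) (\<lambda>i. rcoset_mult R (F (Suc n)) (graded_iso f i) (graded_iso g (n - i))) {..n}"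
    by (simp add: tangent_cone_eq)
  also have "\<dots> = finsum (R Quot F (Suc n))
      (\<lambda>i. F (Suc n) +>\<^bsub>R\<^esub> (homogeneous_part i f * homogeneous_part (n - i) g)) {..n}"
  proof (rule Q.add.finprod_cong')
    show "(\<lambda>i. F (Suc n) +>\<^bsub>R\<^esub> (homogeneous_part i f * homogeneous_part (n - i) g)) \<in> {..n} \<rightarrow> carrier (R Quot F (Suc n))"
      using hom by (auto simp: FactRing_def A_RCOSETS_def' carrier_R)
  qed (auto simp: coset)
  also have "\<dots> = F (Suc n) +>\<^bsub>R\<^esub> (\<Sum>i\<le>n. homogeneous_part i f * homogeneous_part (n - i) g)"
    by (rule finsum_cosets[OF hom])
  also have "\<dots> = graded_iso (graded_mult f g) n"
    unfolding graded_iso_def by (rule coset_eqI[OF homogeneous_part_graded_mult])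
  finally show "graded_iso (graded_mult f g) n = (graded_iso f \<otimes>\<^bsub>tangent_cone T\<^esub> graded_iso g) n" by simp
qed

lemma graded_iso_add: "graded_iso (f + g) = graded_iso f \<oplus>\<^bsub>tangent_cone T\<^esub> graded_iso g"
proof
  fix n
  interpret I: ideal "F (Suc n)" "R :: 'a fps ring" by (rule ideal_F)
  have c: "homogeneous_part n f \<in> carrier R" "homogeneous_part n g \<in> carrier R"
    using homogeneous_part_F F_antimono[of 0 n] by (auto simp: carrier_R)
  have "homogeneous_part n (f + g) = homogeneous_part n f + homogeneous_part n g"
    by (rule fps_ext) (simp add: homogeneous_part_nth)
  then show "graded_iso (f + g) n = (graded_iso f \<oplus>\<^bsub>tangent_cone T\<^esub> graded_iso g) n"
    using I.a_rcos_sum[OF c] by (simp add: graded_iso_def tangent_cone_eq)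
qed

lemma graded_iso_one: "graded_iso (1 :: 'k::field fps) = \<one>\<^bsub>tangent_cone T\<^esub>"
proof
  fix n
  have "homogeneous_part n (1 :: 'k fps) = (if n = 0 then 1 else 0)"
    by (rule fps_ext) (use zero_mem in \<open>auto simp: homogeneous_part_nth\<close>)
  then show "graded_iso (1 :: 'k fps) n = \<one>\<^bsub>tangent_cone T\<^esub> n"
    by (simp add: graded_iso_def tangent_cone_eq coset_0)
qed

lemma graded_iso_inj: "inj_on graded_iso (carrier A)"
proof (rule inj_onI, rule fps_ext)
  fix f g m assume f: "f \<in> carrier A" and g: "g \<in> carrier A" and eq: "graded_iso f = graded_iso g"
  show "f $ m = g $ m"
  proof (cases "m \<in> T")
    case True
    have "homogeneous_part (ord m) f - homogeneous_part (ord m) g \<in> F (Suc (ord m))"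
      using fun_cong[OF eq, of "ord m"] unfolding graded_iso_def by (rule coset_eqD)
    moreover have "m \<notin> multiple T (Suc (ord m))" using multiple_iff_ord[OF True] by simp
    ultimately have "(homogeneous_part (ord m) f - homogeneous_part (ord m) g) $ m = 0"
      by (rule F_nth_eq_0)
    then show ?thesis using True by (simp add: homogeneous_part_nth)
  next
    case False
    then show ?thesis using f g unfolding A_carrier by metis
  qed
qed

lemma graded_iso_surj: 
  assumes "g \<in> carrier (tangent_cone T)"
  shows "\<exists>f\<in>carrier A. graded_iso f = g"
proof -
  have "\<forall>n. \<exists>x\<in>F n. g n = F (Suc n) +>\<^bsub>R\<^esub> x" and fin: "finite {n. g n \<noteq> F (Suc n)}"
    using assms by (auto simp: tangent_cone_eq)
  then obtain x where x: "\<And>n. x n \<in> F n" "\<And>n. g n = F (Suc n) +>\<^bsub>R\<^esub> x n" by metis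
  define f where "f = Abs_fps (\<lambda>m. if m \<in> T \<and> g (ord m) \<noteq> F (Suc (ord m)) then x (ord m) $ m else 0)"
  have f_nth: "f $ m = (if m \<in> T \<and> g (ord m) \<noteq> F (Suc (ord m)) then x (ord m) $ m else 0)" for m
    by (simp add: f_def)
  have "{m. f $ m \<noteq> 0} \<subseteq> (\<Union>n\<in>{n. g n \<noteq> F (Suc n)}. {m \<in> T. ord m \<le> n})"
    by (auto simp: f_nth split: if_splits)
  moreover have "finite (\<Union>n\<in>{n. g n \<noteq> F (Suc n)}. {m \<in> T. ord m \<le> n})"
    using fin finite_ord_le by blast
  ultimately have "finite {m. f $ m \<noteq> 0}" by (rule finite_subset)
  then have "f \<in> carrier A" by (auto simp: A_carrier f_nth)
  moreover have "graded_iso f n = g n" for n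
  proof (cases "g n = F (Suc n)")
    case True
    then have "homogeneous_part n f = 0" by (intro fps_ext) (auto simp: homogeneous_part_nth f_nth)
    then show ?thesis using True by (simp add: graded_iso_def coset_0)
  next
    case False
    have "homogeneous_part n f - x n \<in> F (Suc n)" unfolding F_iff
    proof (intro allI impI)
      fix m assume nz: "(homogeneous_part n f - x n) $ m \<noteq> 0"
      have neq: "\<not> (m \<in> T \<and> ord m = n)"
      proof
        assume "m \<in> T \<and> ord m = n"
        then have "homogeneous_part n f $ m = x n $ m"
          using False by (simp only: homogeneous_part_nth f_nth) simp
        then show False using nz by simp
      qed
      then have "x n $ m \<noteq> 0" using nz by (simp add: homogeneous_part_nth split: if_splits)
      then have m: "m \<in> multiple T n" using x(1) by (auto simp: F_iff)
      then have "m \<in> T" using multiple_subset by blast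
      then show "m \<in> multiple T (Suc n)" using m neq multiple_iff_ord[of m] by force
    qed
    then show ?thesis unfolding x(2) graded_iso_def by (rule coset_eqI)
  qed
  ultimately show ?thesis by blast
qed

lemma graded_iso_ring_iso: "graded_iso \<in> ring_iso A (tangent_cone T)"
proof (rule ring_iso_memI)
  show "bij_betw graded_iso (carrier A) (carrier (tangent_cone T))"
    using graded_iso_inj graded_iso_closed graded_iso_surj by (auto simp: bij_betw_def)
qed (auto simp: graded_iso_closed graded_iso_mult graded_iso_add graded_iso_one)

lemma cring_tangent_cone: "cring (tangent_cone T :: (nat \<Rightarrow> 'k::field fps set) ring)"
proof -
  have "cring ((tangent_cone T :: (nat \<Rightarrow> 'k fps set) ring)\<lparr>zero := graded_iso \<zero>\<^bsub>A\<^esub>\<rparr>)"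
    by (rule cring.ring_iso_imp_img_cring[OF cring_A graded_iso_ring_iso])
  then show ?thesis by (simp add: graded_iso_zero)
qed

text \<open>Garcia's criterion. The isomorphism carries the polynomials in \<open>t^e\<close>, the nilpotent generators and
  the socle element from the monomial algebra to the tangent cone, where they decide whether every
  maximal ideal contains a nonzerodivisor.\<close>

theorem cohen_macaulay_tangent_cone_iff:
  "cohen_macaulay (tangent_cone T :: (nat \<Rightarrow> 'k::field fps set) ring) \<longleftrightarrow> ord_regular"
proof -
  let ?G = "tangent_cone T :: (nat \<Rightarrow> 'k fps set) ring"
  let ?h = "graded_iso :: 'k fps \<Rightarrow> nat \<Rightarrow> 'k fps set"
  interpret G: nilpotent_extension ?G "?h \<circ> \<phi>" "map ?h nilpotent_generators"
    by (rule nilpotent_extension_ring_iso[OF nilpotent_extension_A graded_iso_ring_iso cring_tangent_cone])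
  have inj0: "y = 0" if y: "y \<in> carrier A" "?h y = \<zero>\<^bsub>?G\<^esub>" for y
  proof (rule inj_onD[OF graded_iso_inj _ y(1)])
    show "?h y = ?h 0" using y(2) graded_iso_zero by metis
  qed (simp add: A_carrier)
  show ?thesis
  proof
    assume reg: ord_regular
    show "cohen_macaulay ?G"
    proof (rule G.cohen_macaulayI)
      fix f y assume f: "f \<noteq> 0" and y: "y \<in> carrier ?G" and zero: "(?h \<circ> \<phi>) f \<otimes>\<^bsub>?G\<^esub> y = \<zero>\<^bsub>?G\<^esub>"
      obtain x where x: "x \<in> carrier A" "?h x = y" using graded_iso_surj[OF y] by blast
      then have "?h (graded_mult (\<phi> f) x) = \<zero>\<^bsub>?G\<^esub>" using zero by (simp add: graded_iso_mult)
      then have "graded_mult (\<phi> f) x = 0" by (intro inj0 graded_mult_closed phi_closed x)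
      then have "x = 0" by (rule phi_nonzerodivisor_of_regular[OF reg f x(1)])
      then show "y = \<zero>\<^bsub>?G\<^esub>" using x(2) graded_iso_zero by metis
    qed
  next
    assume CM: "cohen_macaulay ?G"
    show ord_regular
    proof (rule ccontr)
      assume "\<not> ord_regular"
      then obtain y :: "'k fps" where y: "y \<in> carrier A" "y \<noteq> 0" "graded_mult (\<phi> [:0, 1:]) y = 0"
        "\<And>v. v \<in> set nilpotent_generators \<Longrightarrow> graded_mult v y = 0"
        using socle_element_of_irregular by blast
      have "\<not> cohen_macaulay ?G"
      proof (rule G.not_cohen_macaulayI)
        show "?h y \<in> carrier ?G" using graded_iso_closed[OF y(1)] .
        show "?h y \<noteq> \<zero>\<^bsub>?G\<^esub>" using inj0 y(1,2) by blast
        show "(?h \<circ> \<phi>) [:0, 1:] \<otimes>\<^bsub>?G\<^esub> ?h y = \<zero>\<^bsub>?G\<^esub>"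
          using y(3) by (simp add: graded_iso_zero flip: graded_iso_mult)
        show "w \<otimes>\<^bsub>?G\<^esub> ?h y = \<zero>\<^bsub>?G\<^esub>" if "w \<in> set (map ?h nilpotent_generators)" for w
          using that y(4) by (auto simp: graded_iso_zero simp flip: graded_iso_mult)
      qed
      then show False using CM by blast
    qed
  qed
qed

end

section \<open>Tangent cones of specific gluings\<close>

lemma semigroup_gen_gluing:
  "semigroup_gen ((\<lambda>m. q * m) ` A \<union> (\<lambda>n. p * n) ` B) =
     {q * a + p * b | a b. a \<in> semigroup_gen A \<and> b \<in> semigroup_gen B}"
proof (intro equalityI subsetI)
  fix s assume "s \<in> semigroup_gen ((\<lambda>m. q * m) ` A \<union> (\<lambda>n. p * n) ` B)"
  then show "s \<in> {q * a + p * b | a b. a \<in> semigroup_gen A \<and> b \<in> semigroup_gen B}"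
  proof (induction s rule: semigroup_gen.induct)
    case zero
    show ?case using semigroup_gen.zero by (intro CollectI exI[of _ 0]) auto
  next
    case (gen s)
    then consider a where "a \<in> A" "s = q * a + p * 0" | b where "b \<in> B" "s = q * 0 + p * b" by auto
    then show ?case using semigroup_gen.zero semigroup_gen.gen by cases blast+
  next
    case (add s t)
    then obtain a b a' b' where "s = q * a + p * b" "t = q * a' + p * b'"
      and mem: "a \<in> semigroup_gen A" "b \<in> semigroup_gen B" "a' \<in> semigroup_gen A" "b' \<in> semigroup_gen B"
      by blast
    then have "s + t = q * (a + a') + p * (b + b')" by (simp add: algebra_simps)
    then show ?case using mem semigroup_gen.add by blast
  qed
next
  fix s assume "s \<in> {q * a + p * b | a b. a \<in> semigroup_gen A \<and> b \<in> semigroup_gen B}"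
  then obtain a b where ab: "s = q * a + p * b" "a \<in> semigroup_gen A" "b \<in> semigroup_gen B" by blast
  let ?G = "semigroup_gen ((\<lambda>m. q * m) ` A \<union> (\<lambda>n. p * n) ` B)"
  have "q * a \<in> ?G" using ab(2)
    by (induction a rule: semigroup_gen.induct) (auto simp: distrib_left intro: semigroup_gen.intros)
  moreover have "p * b \<in> ?G" using ab(3)
    by (induction b rule: semigroup_gen.induct) (auto simp: distrib_left intro: semigroup_gen.intros)
  ultimately show "s \<in> ?G" unfolding ab(1) by (rule semigroup_gen.add)
qed

text \<open>By Garcia's criterion both sides are statements on orders, which agree for a specific gluing.\<close>

theorem theorem3p16:
  fixes S1 S2 S :: "nat set" and ms ns :: "nat list" and p q :: nat
  assumes "numerical_semigroup S1" and "minimally_generated S1 ms"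
    and "numerical_semigroup S2" and "minimally_generated S2 ns"
    and "specific_gluing ms ns p q S"
  shows "cohen_macaulay (tangent_cone S :: (nat \<Rightarrow> 'k::field fps set) ring) \<longleftrightarrow>
         cohen_macaulay (tangent_cone S1 :: (nat \<Rightarrow> 'k fps set) ring)"
proof -
  have S1: "semigroup_gen (set ms) = S1" and S2: "semigroup_gen (set ns) = S2"
    using assms(2,4) by (auto simp: minimally_generated_def)
  interpret G: specific_semigroup_gluing S1 S2 p q
    using assms(1,3,5) unfolding specific_gluing_def gluing_def S1 S2
    by unfold_locales (auto simp: coprime_iff_gcd_eq_1)
  have S: "S = G.S"
    using assms(5) unfolding specific_gluing_def gluing_def semigroup_gen_gluing G.S_def S1 S2 by blast
  show ?thesis
    unfolding S G.C.cohen_macaulay_tangent_cone_iff G.A.cohen_macaulay_tangent_cone_iff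
    by (rule G.ord_regular_S_iff)
qed

end
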